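(* Let $m=2k+1\ge5$ be an odd integer, let $G=\langle s,t\mid \Pi(s,t,m)=\Pi(t,s,m)\rangle$ be the Artin group of type $I_2(m)$, let $M$ be the submonoid of $G$ generated by $\{s,t\}$, let $\Omega=\Pi(s,t,m)=(st)^ks=(ts)^kt$ and $\Delta=\Omega^2$. Let $G_1$ (resp. $M_1$) be the subgroup (resp. submonoid) generated by $t$, with $\Delta_1=t^2$, and let $H$ (resp. $N$) be the subgroup (resp. submonoid) generated by $s$, with $\Lambda=s^2$. Then, with respect to the Garside structure $(G,M,\Delta)$ and the parabolic substructures $(H,N,\Lambda)$ and $(G_1,M_1,\Delta_1)$, the pair $(H,G_1)$ satisfies Condition A with constant $\zeta=2k-1$ and Condition B with constant $\zeta=2k-1$.
   Context: $\Pi(s,t,m)$ denotes the alternating word $sts\cdots$ of length $m$. For $\alpha,\beta\in G$: $\alpha\le_R\beta$ iff $\beta\alpha^{-1}\in M$. It is known that $(G,M,\Delta)$ is a Garside structure with $\Delta$ central in $G$, and that $(G_1,M_1,\Delta_1)$ and $(H,N,\Lambda)$ are parabolic substructures of it. An element $a\in M$ is unmovable if $\Delta\not\le_R a$. Every $\alpha\in G$ is uniquely $\alpha=a\Delta^j$ with $a\in M$ unmovable and $j\in\mathbb Z$ (the $\Delta$-form of $\alpha$). Depth. For $K\in\{M_1,N\}$ and $a\in M$, $\tau_K(a)$ denotes the unique $b\in K$ with $\{c\in K\mid c\le_R a\}=\{c\in K\mid c\le_R b\}$. Every $a\in M\setminus\{1\}$ is uniquely $a=a_p\cdots a_2a_1$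 with $a_p\ne1$, $a_i=\tau_{M_1}(a_p\cdots a_i)$ for $i$ odd and $a_i=\tau_N(a_p\cdots a_i)$ for $i$ even; set $\mathrm{bh}(a)=p$ and $\mathrm{bh}(1)=1$. The depth is $\mathrm{dpt}(a)=(\mathrm{bh}(a)-1)/2$ if $\mathrm{bh}(a)$ is odd and $\mathrm{bh}(a)/2$ if $\mathrm{bh}(a)$ is even. Conditions A and B. Condition A with constant $\zeta$: $\mathrm{dpt}(\Delta^j)=\zeta j+1$ for all $j\ge1$. Set $\theta=\Delta\Delta_1^{-1}=\Delta_1^{-1}\Delta\in M$, $\Theta=\{\theta^ja_0\mid j\ge1,\ a_0\in M_1\}$ and $\bar\Theta=\Theta\cup M_1$. Condition B with constant $\zeta$: for every $(a,b)\in(M\times M)\setminus(\bar\Theta\times\bar\Theta)$ with $a,b$ both unmovable, writing $ab=c\Delta^p$ for the $\Delta$-form of $ab$, there exists $\varepsilon\in\{0,1\}$ such that $\mathrm{dpt}(c)=\mathrm{dpt}(a)+\mathrm{dpt}(b)-\zeta p-\varepsilon$, and $\varepsilon=1$ if either $a\in\Theta$, or $b\in\Theta$, or $c\in M_1$. *)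

theory Defs
  imports "HOL-Algebra.Generated_Groups"
begin

text \<open>
  A word in the generators is a list of letters; the letter \<open>(x, True)\<close> is the generator \<open>x\<close>
  and \<open>(x, False)\<close> is its formal inverse. A relation is a pair of words.
\<close>

type_synonym 'g gword = "('g \<times> bool) list"

inductive pres_eq :: "('g gword \<times> 'g gword) set \<Rightarrow> 'g gword \<Rightarrow> 'g gword \<Rightarrow> bool"
  for R :: "('g gword \<times> 'g gword) set" where
  refl: "pres_eq R u u"
| sym: "pres_eq R u v \<Longrightarrow> pres_eq R v u"
| trans: "pres_eq R u v \<Longrightarrow> pres_eq R v w \<Longrightarrow> pres_eq R u w"
| append: "pres_eq R u u' \<Longrightarrow> pres_eq R v v' \<Longrightarrow> pres_eq R (u @ v) (u' @ v')"
| cancel: "pres_eq R [(x, e), (x, \<not> e)] []"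
| rel: "(u, v) \<in> R \<Longrightarrow> pres_eq R u v"

definition pres_class :: "('g gword \<times> 'g gword) set \<Rightarrow> 'g gword \<Rightarrow> 'g gword set" where
  "pres_class R u = {v. pres_eq R u v}"

definition presented_group :: "('g gword \<times> 'g gword) set \<Rightarrow> 'g gword set monoid" where
  "presented_group R =
    \<lparr>carrier = range (pres_class R),
     mult = (\<lambda>A B. {w. \<exists>u\<in>A. \<exists>v\<in>B. pres_eq R (u @ v) w}),
     one = pres_class R []\<rparr>"

definition pres_gen :: "('g gword \<times> 'g gword) set \<Rightarrow> 'g \<Rightarrow> 'g gword set" where
  "pres_gen R x = pres_class R [(x, True)]"

lemma pres_class_eq_iff: "pres_class R u = pres_class R v \<longleftrightarrow> pres_eq R u v"
  unfolding pres_class_def by (auto intro: pres_eq.refl pres_eq.sym pres_eq.trans)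

lemma mult_pres_class:
  "pres_class R u \<otimes>\<^bsub>presented_group R\<^esub> pres_class R v = pres_class R (u @ v)"
  unfolding presented_group_def pres_class_def
  by (auto intro: pres_eq.refl pres_eq.sym pres_eq.trans pres_eq.append)

lemma pres_eq_inverse: "pres_eq R (rev (map (\<lambda>(x, e). (x, \<not> e)) u) @ u) []"
proof (induction u)
  case Nil
  show ?case by (simp add: pres_eq.refl)
next
  case (Cons a u)
  obtain x e where a: "a = (x, e)" by (cases a)
  let ?v = "rev (map (\<lambda>(x, e). (x, \<not> e)) u)"
  have "pres_eq R [(x, \<not> e), (x, e)] []"
    using pres_eq.cancel[of R x "\<not> e"] by simp
  then have "pres_eq R (?v @ ([(x, \<not> e), (x, e)] @ u)) (?v @ ([] @ u))"
    by (intro pres_eq.append pres_eq.refl)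
  with Cons.IH show ?case
    by (auto simp: a intro: pres_eq.trans)
qed

lemma group_presented_group: "group (presented_group R)"
proof (rule groupI)
  fix x assume "x \<in> carrier (presented_group R)"
  then obtain u where u: "x = pres_class R u"
    by (auto simp: presented_group_def)
  let ?v = "rev (map (\<lambda>(x, e). (x, \<not> e)) u)"
  have "pres_class R ?v \<otimes>\<^bsub>presented_group R\<^esub> x = \<one>\<^bsub>presented_group R\<^esub>"
    unfolding u mult_pres_class
    by (simp add: presented_group_def pres_class_eq_iff pres_eq_inverse)
  then show "\<exists>y\<in>carrier (presented_group R).
      y \<otimes>\<^bsub>presented_group R\<^esub> x = \<one>\<^bsub>presented_group R\<^esub>"
    by (auto simp: presented_group_def)
next
  fix x y assume "x \<in> carrier (presented_group R)" "y \<in> carrier (presented_group R)"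
  then obtain u v where "x = pres_class R u" "y = pres_class R v"
    by (auto simp: presented_group_def)
  then show "x \<otimes>\<^bsub>presented_group R\<^esub> y \<in> carrier (presented_group R)"
    by (simp only: mult_pres_class) (simp add: presented_group_def)
next
  show "\<one>\<^bsub>presented_group R\<^esub> \<in> carrier (presented_group R)"
    by (simp add: presented_group_def)
next
  fix x y z
  assume "x \<in> carrier (presented_group R)" "y \<in> carrier (presented_group R)"
    "z \<in> carrier (presented_group R)"
  then obtain u v w where "x = pres_class R u" "y = pres_class R v" "z = pres_class R w"
    by (auto simp: presented_group_def)
  then show "x \<otimes>\<^bsub>presented_group R\<^esub> y \<otimes>\<^bsub>presented_group R\<^esub> z =
      x \<otimes>\<^bsub>presented_group R\<^esub> (y \<otimes>\<^bsub>presented_group R\<^esub> z)"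
    by (simp add: mult_pres_class)
next
  fix x assume "x \<in> carrier (presented_group R)"
  then obtain u where u: "x = pres_class R u"
    by (auto simp: presented_group_def)
  have one: "\<one>\<^bsub>presented_group R\<^esub> = pres_class R []"
    by (simp add: presented_group_def)
  show "\<one>\<^bsub>presented_group R\<^esub> \<otimes>\<^bsub>presented_group R\<^esub> x = x"
    unfolding u one mult_pres_class by simp
qed

fun alt_word :: "'a \<Rightarrow> 'a \<Rightarrow> nat \<Rightarrow> 'a list" where
  "alt_word x y 0 = []"
| "alt_word x y (Suc n) = x # alt_word y x n"

datatype artin_gen = Gen_s | Gen_t

definition artin_I2_rels :: "nat \<Rightarrow> (artin_gen gword \<times> artin_gen gword) set" where
  "artin_I2_rels m =
    {(alt_word (Gen_s, True) (Gen_t, True) m, alt_word (Gen_t, True) (Gen_s, True) m)}"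

definition artin_I2 :: "nat \<Rightarrow> artin_gen gword set monoid" where
  "artin_I2 m = presented_group (artin_I2_rels m)"

definition artin_s :: "nat \<Rightarrow> artin_gen gword set" where
  "artin_s m = pres_gen (artin_I2_rels m) Gen_s"

definition artin_t :: "nat \<Rightarrow> artin_gen gword set" where
  "artin_t m = pres_gen (artin_I2_rels m) Gen_t"

definition list_prod :: "('a, 'b) monoid_scheme \<Rightarrow> 'a list \<Rightarrow> 'a" where
  "list_prod G xs = foldr (mult G) xs (one G)"

definition alt_prod :: "('a, 'b) monoid_scheme \<Rightarrow> 'a \<Rightarrow> 'a \<Rightarrow> nat \<Rightarrow> 'a" where
  "alt_prod G x y n = list_prod G (alt_word x y n)"

definition submonoid_generated :: "('a, 'b) monoid_scheme \<Rightarrow> 'a set \<Rightarrow> 'a set" where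
  "submonoid_generated G A = \<Inter>{S. submonoid S G \<and> A \<subseteq> S}"

text \<open>
  A Garside structure \<open>(G, M, \<Delta>)\<close> is given by a group \<open>G\<close>, a submonoid \<open>M\<close> of \<open>G\<close> and a
  Garside element \<open>\<Delta>\<close>. Definite descriptions below are used only where existence and
  uniqueness hold in a Garside structure with central \<open>\<Delta>\<close>.
\<close>

definition le_R :: "('a, 'b) monoid_scheme \<Rightarrow> 'a set \<Rightarrow> 'a \<Rightarrow> 'a \<Rightarrow> bool" where
  "le_R G M \<alpha> \<beta> \<longleftrightarrow> \<beta> \<otimes>\<^bsub>G\<^esub> inv\<^bsub>G\<^esub> \<alpha> \<in> M"

definition unmovable :: "('a, 'b) monoid_scheme \<Rightarrow> 'a set \<Rightarrow> 'a \<Rightarrow> 'a \<Rightarrow> bool" where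
  "unmovable G M \<Delta> a \<longleftrightarrow> a \<in> M \<and> \<not> le_R G M \<Delta> a"

definition Delta_form :: "('a, 'b) monoid_scheme \<Rightarrow> 'a set \<Rightarrow> 'a \<Rightarrow> 'a \<Rightarrow> 'a \<times> int" where
  "Delta_form G M \<Delta> \<alpha> =
    (THE (a, j). unmovable G M \<Delta> a \<and> \<alpha> = a \<otimes>\<^bsub>G\<^esub> (\<Delta> [^]\<^bsub>G\<^esub> j))"

definition tail :: "('a, 'b) monoid_scheme \<Rightarrow> 'a set \<Rightarrow> 'a set \<Rightarrow> 'a \<Rightarrow> 'a" where
  "tail G M K a = (THE b. b \<in> K \<and> {c \<in> K. le_R G M c a} = {c \<in> K. le_R G M c b})"

text \<open>
  \<open>alternating_form G M N M\<^sub>1 a p f\<close> says that \<open>a = f p \<cdots> f 2 \<cdot> f 1\<close> is the alternating form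
  of \<open>a\<close>; note the decreasing order of the factors.
\<close>

definition alternating_form ::
  "('a, 'b) monoid_scheme \<Rightarrow> 'a set \<Rightarrow> 'a set \<Rightarrow> 'a set \<Rightarrow> 'a \<Rightarrow> nat \<Rightarrow> (nat \<Rightarrow> 'a) \<Rightarrow> bool" where
  "alternating_form G M N M\<^sub>1 a p f \<longleftrightarrow>
    1 \<le> p \<and> (\<forall>i\<in>{1..p}. f i \<in> M) \<and>
    a = list_prod G (map f (rev [1..<Suc p])) \<and>
    f p \<noteq> \<one>\<^bsub>G\<^esub> \<and>
    (\<forall>i\<in>{1..p}. f i = tail G M (if odd i then M\<^sub>1 else N) (list_prod G (map f (rev [i..<Suc p]))))"

definition breadth :: "('a, 'b) monoid_scheme \<Rightarrow> 'a set \<Rightarrow> 'a set \<Rightarrow> 'a set \<Rightarrow> 'a \<Rightarrow> nat" where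
  "breadth G M N M\<^sub>1 a =
    (if a = \<one>\<^bsub>G\<^esub> then 1 else (THE p. \<exists>f. alternating_form G M N M\<^sub>1 a p f))"

definition depth :: "('a, 'b) monoid_scheme \<Rightarrow> 'a set \<Rightarrow> 'a set \<Rightarrow> 'a set \<Rightarrow> 'a \<Rightarrow> nat" where
  "depth G M N M\<^sub>1 a =
    (let p = breadth G M N M\<^sub>1 a in if odd p then (p - 1) div 2 else p div 2)"

definition garside_theta :: "('a, 'b) monoid_scheme \<Rightarrow> 'a \<Rightarrow> 'a \<Rightarrow> 'a" where
  "garside_theta G \<Delta> \<Delta>\<^sub>1 = \<Delta> \<otimes>\<^bsub>G\<^esub> inv\<^bsub>G\<^esub> \<Delta>\<^sub>1"

definition Theta :: "('a, 'b) monoid_scheme \<Rightarrow> 'a \<Rightarrow> 'a set \<Rightarrow> 'a \<Rightarrow> 'a set" where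
  "Theta G \<Delta> M\<^sub>1 \<Delta>\<^sub>1 =
    {(garside_theta G \<Delta> \<Delta>\<^sub>1 [^]\<^bsub>G\<^esub> j) \<otimes>\<^bsub>G\<^esub> a\<^sub>0 | (j::nat) a\<^sub>0. 1 \<le> j \<and> a\<^sub>0 \<in> M\<^sub>1}"

definition Theta_bar :: "('a, 'b) monoid_scheme \<Rightarrow> 'a \<Rightarrow> 'a set \<Rightarrow> 'a \<Rightarrow> 'a set" where
  "Theta_bar G \<Delta> M\<^sub>1 \<Delta>\<^sub>1 = Theta G \<Delta> M\<^sub>1 \<Delta>\<^sub>1 \<union> M\<^sub>1"

text \<open>
  The arguments are the Garside structure \<open>(G, M, \<Delta>)\<close>, the parabolic substructures
  \<open>(H, N, \<Lambda>)\<close> and \<open>(G\<^sub>1, M\<^sub>1, \<Delta>\<^sub>1)\<close>, and the constant \<open>\<zeta>\<close>.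
  The components \<open>H\<close>, \<open>\<Lambda>\<close> and \<open>G\<^sub>1\<close> do not enter the two conditions.
\<close>

fun condition_A ::
  "('a, 'b) monoid_scheme \<times> 'a set \<times> 'a \<Rightarrow> 'a set \<times> 'a set \<times> 'a \<Rightarrow> 'a set \<times> 'a set \<times> 'a
    \<Rightarrow> nat \<Rightarrow> bool" where
  "condition_A (G, M, \<Delta>) (H, N, \<Lambda>) (G\<^sub>1, M\<^sub>1, \<Delta>\<^sub>1) \<zeta> \<longleftrightarrow>
    (\<forall>j::nat. 1 \<le> j \<longrightarrow> depth G M N M\<^sub>1 (\<Delta> [^]\<^bsub>G\<^esub> j) = \<zeta> * j + 1)"

fun condition_B ::
  "('a, 'b) monoid_scheme \<times> 'a set \<times> 'a \<Rightarrow> 'a set \<times> 'a set \<times> 'a \<Rightarrow> 'a set \<times> 'a set \<times> 'a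
    \<Rightarrow> nat \<Rightarrow> bool" where
  "condition_B (G, M, \<Delta>) (H, N, \<Lambda>) (G\<^sub>1, M\<^sub>1, \<Delta>\<^sub>1) \<zeta> \<longleftrightarrow>
    (\<forall>(a, b) \<in> (M \<times> M) - (Theta_bar G \<Delta> M\<^sub>1 \<Delta>\<^sub>1 \<times> Theta_bar G \<Delta> M\<^sub>1 \<Delta>\<^sub>1).
      unmovable G M \<Delta> a \<and> unmovable G M \<Delta> b \<longrightarrow>
      (let (c, p) = Delta_form G M \<Delta> (a \<otimes>\<^bsub>G\<^esub> b) in
        \<exists>\<epsilon>::int. \<epsilon> \<in> {0, 1} \<and>
          int (depth G M N M\<^sub>1 c) =
            int (depth G M N M\<^sub>1 a) + int (depth G M N M\<^sub>1 b) - int \<zeta> * p - \<epsilon> \<and>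
          (a \<in> Theta G \<Delta> M\<^sub>1 \<Delta>\<^sub>1 \<or> b \<in> Theta G \<Delta> M\<^sub>1 \<Delta>\<^sub>1 \<or> c \<in> M\<^sub>1 \<longrightarrow> \<epsilon> = 1)))"

end

theory Submission
  imports Defs Complex_Main
begin

text \<open>
  Put \<open>m = 2 * k + 1\<close>. The group acts on \<open>\<real>\<close> by increasing piecewise linear bijections: let
  \<open>Y r = r + 1\<close> and let \<open>X\<close> be a half turn, so that \<open>X\<^sup>2\<close> and \<open>Y\<^sup>m\<close> are both translation by \<open>m\<close>; then
  \<open>s = Y\<^sup>-\<^sup>1 X\<close> and \<open>t = X Y\<^sup>-\<^sup>1\<close> satisfy the braid relation, \<open>t\<close> fixes \<open>1\<close>, and \<open>\<Delta>\<close> is translation by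
  \<open>m (2 k - 1)\<close>.

  The alternating form of \<open>a\<close> spells \<open>a = v t\<^sup>j\<close> with \<open>t\<close> not dividing \<open>v\<close> on the right. Since \<open>\<Omega> w\<close> is
  always divisible by \<open>t\<close>, no word for \<open>v\<close> contains an alternating subword of length \<open>m\<close>, and
  following the orbit of \<open>1\<close> along such a word shows that every new block of letters \<open>s\<close> moves it
  into the next interval \<open>[1 + m n, 1 + m (n + 1))\<close>. Hence, for \<open>a\<close> outside \<open>M\<^sub>1\<close>, the depth of \<open>a\<close> is
  \<open>n + 1\<close> if \<open>a\<close> sends \<open>1\<close> into this interval, and \<open>a\<close> sends \<open>1\<close> to its left endpoint only if
  \<open>a\<close> lies in \<open>\<Theta>\<close>. Condition A is immediate, and Condition B expresses that \<open>n\<close> is additive up to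
  an error in \<open>{0, 1}\<close> for increasing maps which commute with translation by \<open>m\<close>.
\<close>

section \<open>Actions of a presented group\<close>

text \<open>Free cancellation and the given relations generate \<open>pres_eq\<close>, so letters
  that respect both act in the same way along equivalent words.\<close>

lemma foldr_pres_eq:
  assumes "pres_eq R u v"
    and canc: "\<And>x e r. h (x, e) (h (x, \<not> e) r) = r"
    and rels: "\<And>u v. (u, v) \<in> R \<Longrightarrow> foldr h u = foldr h v"
  shows "foldr h u = foldr h v"
  using assms(1) by induction (auto simp: fun_eq_iff canc rels)

text \<open>The representative picked by \<open>SOME\<close> is harmless once \<open>h\<close>
  respects cancellation and the relations, see \<open>class_act_pres_class\<close>.\<close>

definition class_act :: "('g gword \<times> 'g gword) set \<Rightarrow> ('g \<times> bool \<Rightarrow> 'c \<Rightarrow> 'c) \<Rightarrow> 'g gword set \<Rightarrow> 'c \<Rightarrow> 'c"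
  where "class_act R h A = foldr h (SOME u. A = pres_class R u)"

context
  fixes R :: "('g gword \<times> 'g gword) set" and h :: "'g \<times> bool \<Rightarrow> 'c \<Rightarrow> 'c"
  assumes canc: "\<And>x e r. h (x, e) (h (x, \<not> e) r) = r"
    and rels: "\<And>u v. (u, v) \<in> R \<Longrightarrow> foldr h u = foldr h v"
begin

lemma class_act_pres_class: "class_act R h (pres_class R u) = foldr h u"
proof -
  have "pres_class R u = pres_class R (SOME v. pres_class R u = pres_class R v)"
    by (rule someI) (rule HOL.refl)
  then have "pres_eq R u (SOME v. pres_class R u = pres_class R v)"
    by (simp only: pres_class_eq_iff)
  from foldr_pres_eq[OF this canc rels] show ?thesis
    by (simp add: class_act_def)
qed

lemma class_act_one: "class_act R h \<one>\<^bsub>presented_group R\<^esub> r = r"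
  by (simp add: presented_group_def class_act_pres_class)

lemma class_act_mult:
  assumes "x \<in> carrier (presented_group R)" "y \<in> carrier (presented_group R)"
  shows "class_act R h (x \<otimes>\<^bsub>presented_group R\<^esub> y) r = class_act R h x (class_act R h y r)"
proof -
  obtain u v where "x = pres_class R u" "y = pres_class R v"
    using assms by (auto simp: presented_group_def)
  then show ?thesis
    by (simp only: mult_pres_class class_act_pres_class) simp
qed

end

section \<open>A piecewise linear half turn\<close>

text \<open>
  The line \<open>\<real>\<close> covers a circle of length \<open>m\<close>. The unit rotation has \<open>m\<close>-th power equal to the
  full turn, and so has the square of \<open>half_turn m\<close>, which exchanges the arcs \<open>[0, 1)\<close> and
  \<open>[1, m)\<close>.
\<close>

definition half_turn :: "nat \<Rightarrow> real \<Rightarrow> real" where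
  "half_turn m r = (let n = \<lfloor>r / m\<rfloor>; q = r - real m * of_int n in
    real m * of_int n + (if q < 1 then 1 + (real m - 1) * q else m + (q - 1) / (real m - 1)))"

context
  fixes m :: nat
  assumes m: "2 \<le> m"
begin

lemma floor_cell:
  fixes n :: int
  assumes "real m * of_int n \<le> r" "r < real m * of_int n + m"
  shows "\<lfloor>r / m\<rfloor> = n"
  using assms m by (simp add: floor_eq_iff field_simps)

lemma half_turn_short:
  fixes n :: int
  assumes "real m * of_int n \<le> r" "r < real m * of_int n + 1"
  shows "half_turn m r = real m * of_int n + 1 + (real m - 1) * (r - real m * of_int n)"
  using assms m floor_cell[of n r] by (simp add: half_turn_def Let_def)

lemma half_turn_long:
  fixes n :: int
  assumes "real m * of_int n + 1 \<le> r" "r < real m * of_int n + m"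
  shows "half_turn m r = real m * of_int n + m + (r - real m * of_int n - 1) / (real m - 1)"
  using assms m floor_cell[of n r] by (simp add: half_turn_def Let_def)

lemma half_turn_shift: "half_turn m (r + real m * of_int j) = half_turn m r + real m * of_int j"
proof -
  have "(r + real m * of_int j) / m = r / m + of_int j" using m by (simp add: field_simps)
  then have "\<lfloor>(r + real m * of_int j) / m\<rfloor> = \<lfloor>r / m\<rfloor> + j" by simp
  then show ?thesis by (simp add: half_turn_def Let_def algebra_simps)
qed

lemma cell_cases:
  obtains (short) n :: int where "real m * of_int n \<le> r" "r < real m * of_int n + 1"
  | (long) n :: int where "real m * of_int n + 1 \<le> r" "r < real m * of_int n + m"
proof -
  have "real m * of_int \<lfloor>r / m\<rfloor> \<le> r" "r < real m * of_int \<lfloor>r / m\<rfloor> + m"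
    using m floor_divide_lower[of "real m" r] floor_divide_upper[of "real m" r]
    by (simp_all add: algebra_simps)
  then show thesis using short[of "\<lfloor>r / m\<rfloor>"] long[of "\<lfloor>r / m\<rfloor>"] by linarith
qed

text \<open>The slopes m - 1 and 1 / (m - 1) on the two arcs are reciprocal, and each arc is carried
  onto the next one.\<close>

lemma half_turn_twice: "half_turn m (half_turn m r) = r + m"
proof (cases rule: cell_cases[of r])
  case (short n)
  have "0 \<le> (real m - 1) * (r - real m * of_int n)" "(real m - 1) * (r - real m * of_int n) < real m - 1"
    using m short mult_strict_left_mono[of "r - real m * of_int n" 1 "real m - 1"]
    by (auto simp: mult_nonneg_nonneg)
  then have "half_turn m (half_turn m r) = real m * of_int n + m + (half_turn m r - real m * of_int n - 1) / (real m - 1)"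
    using half_turn_short[OF short] by (intro half_turn_long) auto
  then show ?thesis using half_turn_short[OF short] m by simp
next
  case (long n)
  have "0 \<le> (r - real m * of_int n - 1) / (real m - 1)" "(r - real m * of_int n - 1) / (real m - 1) < 1"
    using m long by (auto simp: divide_simps)
  moreover have eq: "half_turn m r - real m * of_int (n + 1) = (r - real m * of_int n - 1) / (real m - 1)"
    using half_turn_long[OF long] by (simp add: algebra_simps)
  ultimately have "half_turn m (half_turn m r) =
      real m * of_int (n + 1) + 1 + (real m - 1) * (half_turn m r - real m * of_int (n + 1))"
    by (intro half_turn_short) linarith+
  also have "\<dots> = real m * of_int (n + 1) + 1 + (r - real m * of_int n - 1)"
    unfolding eq using m by simp
  finally show ?thesis by (simp add: algebra_simps)
qed

text \<open>The period [m n, m (n + 1)) is sent into [m n + 1, m (n + 1) + 1), so distinct periods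
  keep their order. Inside one period the two pieces are increasing and their images are separated
  by m (n + 1).\<close>

lemma half_turn_strict_mono: "strict_mono (half_turn m)"
proof (rule strict_monoI)
  fix r r' :: real
  assume "r < r'"
  have m1: "real m - 1 > 0" using m by simp
  have bounds: "m * of_int n + 1 \<le> half_turn m x \<and> half_turn m x < m * of_int n + m + 1"
    if "n = \<lfloor>x / m\<rfloor>" for n x
  proof (cases rule: cell_cases[of x])
    case (short l)
    have "n = l" using that short m floor_cell[of l x] by simp
    moreover have "(real m - 1) * (x - real m * of_int l) < real m - 1" "0 \<le> (real m - 1) * (x - real m * of_int l)"
      using m1 short mult_strict_left_mono[of "x - real m * of_int l" 1 "real m - 1"] by auto
    ultimately show ?thesis using half_turn_short[OF short] by simp
  next
    case (long l)
    have "n = l" using that long m floor_cell[of l x] by simp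
    moreover have "0 \<le> (x - real m * of_int l - 1) / (real m - 1)" "(x - real m * of_int l - 1) / (real m - 1) < 1"
      using m long by (auto simp: divide_simps)
    ultimately show ?thesis using half_turn_long[OF long] m by simp
  qed
  consider "\<lfloor>r / m\<rfloor> < \<lfloor>r' / m\<rfloor>" | "\<lfloor>r / m\<rfloor> = \<lfloor>r' / m\<rfloor>"
    using floor_mono[of "r / m" "r' / m"] \<open>r < r'\<close> m by (force simp: divide_simps)
  then show "half_turn m r < half_turn m r'"
  proof cases
    case 1
    then have "real m * (of_int \<lfloor>r / m\<rfloor> + 1) \<le> real m * of_int \<lfloor>r' / m\<rfloor>"
      by (intro mult_left_mono) linarith+
    then show ?thesis using bounds[OF HOL.refl, of r] bounds[OF HOL.refl, of r']
      by (simp add: algebra_simps)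
  next
    case 2
    define n where "n = \<lfloor>r / m\<rfloor>"
    have le: "real m * of_int n \<le> r" "r' < real m * of_int n + m"
      using 2 m floor_divide_lower[of "real m" r] floor_divide_upper[of "real m" r']
      by (auto simp: n_def algebra_simps)
    consider "r' < real m * of_int n + 1" | "real m * of_int n + 1 \<le> r" | "r < real m * of_int n + 1" "real m * of_int n + 1 \<le> r'"
      by linarith
    then show ?thesis
    proof cases
      case 1
      then show ?thesis using half_turn_short[of n r] half_turn_short[of n r'] le \<open>r < r'\<close> m1
        by (simp add: mult.commute)
    next
      case 2
      then show ?thesis using half_turn_long[of n r] half_turn_long[of n r'] le \<open>r < r'\<close> m1
        by (simp add: mult.commute divide_strict_right_mono)
    next
      case 3
      have "(real m - 1) * (r - real m * of_int n) < real m - 1"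
        using m1 3 mult_strict_left_mono[of "r - real m * of_int n" 1 "real m - 1"] by auto
      moreover have "0 \<le> (r' - real m * of_int n - 1) / (real m - 1)"
        using m 3 by (auto simp: divide_simps)
      ultimately show ?thesis
        using half_turn_short[OF le(1) 3(1)] half_turn_long[OF 3(2) le(2)] by linarith
    qed
  qed
qed

end

section \<open>Words and generated submonoids\<close>

context monoid
begin

lemma list_prod_Nil [simp]: "list_prod G [] = \<one>"
  by (simp add: list_prod_def)

lemma list_prod_Cons [simp]: "list_prod G (x # xs) = x \<otimes> list_prod G xs"
  by (simp add: list_prod_def)

lemma list_prod_closed [intro, simp]: "set xs \<subseteq> carrier G \<Longrightarrow> list_prod G xs \<in> carrier G"
  by (induction xs) auto

lemma list_prod_append:
  "set xs \<subseteq> carrier G \<Longrightarrow> set ys \<subseteq> carrier G \<Longrightarrow>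
    list_prod G (xs @ ys) = list_prod G xs \<otimes> list_prod G ys"
  by (induction xs) (auto simp: m_assoc)

lemma submonoid_generated_eq:
  assumes "A \<subseteq> carrier G"
  shows "submonoid_generated G A = {list_prod G xs | xs. set xs \<subseteq> A}"
proof
  have sub: "submonoid {list_prod G xs | xs. set xs \<subseteq> A} G"
  proof
    show "{list_prod G xs | xs. set xs \<subseteq> A} \<subseteq> carrier G" using assms by auto
    show "\<one> \<in> {list_prod G xs | xs. set xs \<subseteq> A}" by (auto intro!: exI[of _ "[]"])
    fix x y assume "x \<in> {list_prod G xs | xs. set xs \<subseteq> A}" "y \<in> {list_prod G xs | xs. set xs \<subseteq> A}"
    then obtain xs ys where "x = list_prod G xs" "y = list_prod G ys" "set xs \<subseteq> A" "set ys \<subseteq> A"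
      by auto
    then show "x \<otimes> y \<in> {list_prod G xs | xs. set xs \<subseteq> A}"
      using assms by (auto intro!: exI[of _ "xs @ ys"] simp: list_prod_append)
  qed
  have "A \<subseteq> {list_prod G xs | xs. set xs \<subseteq> A}"
  proof
    fix x assume "x \<in> A"
    then show "x \<in> {list_prod G xs | xs. set xs \<subseteq> A}"
      using assms by (auto intro!: exI[of _ "[x]"])
  qed
  with sub show "submonoid_generated G A \<subseteq> {list_prod G xs | xs. set xs \<subseteq> A}"
    unfolding submonoid_generated_def by blast
next
  have "list_prod G xs \<in> S" if "submonoid S G" "A \<subseteq> S" "set xs \<subseteq> A" for xs S
    using that(3)
    by (induction xs) (use that(1,2) in \<open>auto simp: submonoid.one_closed submonoid.m_closed\<close>)
  then show "{list_prod G xs | xs. set xs \<subseteq> A} \<subseteq> submonoid_generated G A"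
    unfolding submonoid_generated_def by blast
qed

lemma list_prod_replicate: "x \<in> carrier G \<Longrightarrow> list_prod G (replicate n x) = x [^] n"
  by (induction n) (simp_all flip: nat_pow_Suc2)

lemma submonoid_generated_singleton:
  assumes "x \<in> carrier G"
  shows "submonoid_generated G {x} = range (\<lambda>n::nat. x [^] n)"
proof -
  have "list_prod G xs = x [^] length xs" if "set xs \<subseteq> {x}" for xs
  proof -
    have "replicate (length xs) x = xs" using that by (intro replicate_length_same) auto
    then show ?thesis using list_prod_replicate[OF assms, of "length xs"] by simp
  qed
  moreover have "\<exists>xs. x [^] n = list_prod G xs \<and> set xs \<subseteq> {x}" for n :: nat
    by (rule exI[of _ "replicate n x"]) (auto simp: list_prod_replicate assms)
  ultimately show ?thesis
    using assms by (subst submonoid_generated_eq) auto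
qed

end

section \<open>Alternating prefixes and blocks of words\<close>

fun alt_run :: "'a list \<Rightarrow> nat" where
  "alt_run [] = 0"
| "alt_run [x] = 1"
| "alt_run (x # y # w) = (if x = y then 1 else Suc (alt_run (y # w)))"

text \<open>The number of maximal runs of \<open>True\<close>, each counted at its last
  letter.\<close>

fun true_blocks :: "bool list \<Rightarrow> nat" where
  "true_blocks [] = 0"
| "true_blocks (x # w) = true_blocks w + (if x \<and> (w = [] \<or> \<not> hd w) then 1 else 0)"

lemma alt_run_pos: "w \<noteq> [] \<Longrightarrow> 1 \<le> alt_run w"
  by (induction w rule: alt_run.induct) auto

lemma take_alt_run: "n \<le> alt_run (x # w) \<Longrightarrow> take n (x # w) = alt_word x (\<not> x) n"
proof (induction w arbitrary: x n)
  case Nil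
  then show ?case by (cases n) auto
next
  case (Cons y w)
  show ?case
  proof (cases n)
    case (Suc l)
    show ?thesis
    proof (cases "x = y")
      case True
      with Cons.prems Suc show ?thesis by (cases l) auto
    next
      case False
      then have "(\<not> x) = y" by blast
      with Cons.prems Suc Cons.IH[of l y] False show ?thesis by auto
    qed
  qed simp
qed

text \<open>The condition on \<open>last w\<close> keeps the appended run from merging with the one
  before it.\<close>

lemma true_blocks_append_replicate:
  assumes "1 \<le> e" "w \<noteq> [] \<longrightarrow> last w \<noteq> x"
  shows "true_blocks (w @ replicate e x) = true_blocks w + (if x then 1 else 0)"
  using assms(2)
proof (induction w)
  case Nil
  have "true_blocks (replicate (Suc n) x) = (if x then 1 else 0)" for n
    by (induction n) auto
  then show ?case using assms(1) by (cases e) auto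
next
  case (Cons y w)
  then show ?case using assms(1) by (cases w; cases e) auto
qed

lemma alt_word_Suc_right:
  "alt_word b (\<not> b) (Suc n) = alt_word b (\<not> b) n @ [if even n then b else \<not> b]"
proof (induction n arbitrary: b)
  case (Suc n)
  have "alt_word b (\<not> b) (Suc (Suc n)) = b # alt_word (\<not> b) (\<not> \<not> b) (Suc n)"
    by simp
  also have "\<dots> = b # alt_word (\<not> b) (\<not> \<not> b) n @ [if even n then \<not> b else b]"
    by (subst Suc.IH) simp
  finally show ?case by simp
qed simp

lemma map_Not_alt_word: "map Not (alt_word b (\<not> b) n) = alt_word (\<not> b) b n"
proof (induction n arbitrary: b)
  case (Suc n)
  show ?case using Suc.IH[of "\<not> b"] by simp
qed simp

section \<open>Dihedral Garside monoids acting on the line\<close>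

text \<open>Collects what the argument takes from the Artin group: the braid relation, the action on
  the line and a length homomorphism. The presentation returns only when the locale is
  interpreted.\<close>

locale dihedral_action = group G for G (structure) +
  fixes s t :: 'a and k :: nat and act :: "'a \<Rightarrow> real \<Rightarrow> real" and len :: "'a \<Rightarrow> int"
  assumes k_pos: "1 \<le> k"
    and s_closed [simp]: "s \<in> carrier G"
    and t_closed [simp]: "t \<in> carrier G"
    and braid: "alt_prod G s t (2 * k + 1) = alt_prod G t s (2 * k + 1)"
    and act_one [simp]: "act \<one> r = r"
    and act_mult: "x \<in> carrier G \<Longrightarrow> y \<in> carrier G \<Longrightarrow> act (x \<otimes> y) r = act x (act y r)"
    and act_s: "act s r = half_turn (2 * k + 1) r - 1"
    and act_t: "act t r = half_turn (2 * k + 1) (r - 1)"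
    and len_mult: "x \<in> carrier G \<Longrightarrow> y \<in> carrier G \<Longrightarrow> len (x \<otimes> y) = len x + len y"
    and len_s [simp]: "len s = 1"
    and len_t [simp]: "len t = 1"
begin

text \<open>Booleans name the generators so that exchanging s and t is negation;
  \<open>powers True\<close> becomes N and \<open>powers False\<close> becomes
  \<open>M\<^sub>1\<close>.\<close>

definition letter :: "bool \<Rightarrow> 'a" where
  "letter b = (if b then s else t)"

definition ev :: "bool list \<Rightarrow> 'a" where
  "ev w = list_prod G (map letter w)"

definition alt :: "bool \<Rightarrow> nat \<Rightarrow> 'a" where
  "alt b n = ev (alt_word b (\<not> b) n)"

abbreviation M :: "'a set" where "M \<equiv> submonoid_generated G {s, t}"
definition powers :: "bool \<Rightarrow> 'a set" where "powers b = range (\<lambda>n::nat. letter b [^] n)"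

definition \<Omega> :: 'a where "\<Omega> = alt_prod G s t (2 * k + 1)"
definition \<Delta> :: 'a where "\<Delta> = \<Omega> [^] (2::nat)"
text \<open>An explicit positive word, (st)^k (ts)^k, whose suffixes can be named later;
  \<open>garside_theta_eq\<close> identifies it with the element of the theorem.\<close>

definition \<theta> :: 'a where "\<theta> = alt True (2 * k) \<otimes> alt False (2 * k)"

lemma letter_simps [simp]: "letter True = s" "letter False = t" "letter b \<in> carrier G"
  by (auto simp: letter_def)

lemma ev_closed [simp]: "ev w \<in> carrier G"
  by (auto simp: ev_def intro!: list_prod_closed)

lemma ev_Nil [simp]: "ev [] = \<one>"
  by (simp add: ev_def)

lemma ev_Cons [simp]: "ev (b # w) = letter b \<otimes> ev w"
  by (simp add: ev_def)

lemma ev_append: "ev (v @ w) = ev v \<otimes> ev w"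
  unfolding ev_def map_append by (rule list_prod_append) auto

lemma ev_replicate: "ev (replicate n b) = letter b [^] n"
  by (simp add: ev_def list_prod_replicate)

lemma M_eq: "M = range ev"
proof -
  have "\<exists>w. list_prod G xs = ev w" if "set xs \<subseteq> {s, t}" for xs
    using that
  proof (induction xs)
    case Nil
    show ?case by (intro exI[of _ "[]"]) simp
  next
    case (Cons x xs)
    then obtain w where "list_prod G xs = ev w" by auto
    with Cons.prems show ?case
      by (intro exI[of _ "(x = s) # w"]) (auto simp: letter_def)
  qed
  moreover have "\<exists>xs. ev w = list_prod G xs \<and> set xs \<subseteq> {s, t}" for w
    by (rule exI[of _ "map letter w"]) (auto simp: ev_def letter_def)
  ultimately show ?thesis
    by (subst submonoid_generated_eq) (auto, blast)
qed

lemma ev_in_M [simp]: "ev w \<in> M"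
  by (simp add: M_eq)

lemma M_closed: "a \<in> M \<Longrightarrow> a \<in> carrier G"
  by (auto simp: M_eq)

lemma M_mult: "a \<in> M \<Longrightarrow> b \<in> M \<Longrightarrow> a \<otimes> b \<in> M"
  by (auto simp: M_eq simp flip: ev_append)

lemma letter_in_M [simp]: "letter b \<in> M"
  using ev_in_M[of "[b]"] by simp

lemma one_in_M [simp]: "\<one> \<in> M"
  using ev_in_M[of "[]"] by simp

lemma pow_in_M: "a \<in> M \<Longrightarrow> a [^] (n::nat) \<in> M"
  by (induction n) (auto intro: M_mult)

lemma submonoid_generated_letter: "submonoid_generated G {letter b} = powers b"
  by (simp add: submonoid_generated_singleton powers_def)

lemma powers_subset_M: "powers b \<subseteq> M"
  by (auto simp: powers_def intro: pow_in_M)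

lemma alt_closed [simp]: "alt b n \<in> carrier G"
  by (simp add: alt_def)

lemma alt_0 [simp]: "alt b 0 = \<one>"
  by (simp add: alt_def)

lemma alt_Suc: "alt b (Suc n) = letter b \<otimes> alt (\<not> b) n"
  by (simp add: alt_def)

lemma alt_Suc_right: "alt b (Suc n) = alt b n \<otimes> letter (if even n then b else \<not> b)"
  unfolding alt_def alt_word_Suc_right ev_append by simp

lemma alt_prod_eq_alt: "alt_prod G (letter b) (letter (\<not> b)) n = alt b n"
proof -
  have "map letter (alt_word x y n) = alt_word (letter x) (letter y) n" for x y
    by (induction n arbitrary: x y) auto
  then show ?thesis by (simp add: alt_prod_def alt_def ev_def)
qed

lemma \<Omega>_eq_alt: "\<Omega> = alt b (2 * k + 1)"
  using alt_prod_eq_alt[of True "2 * k + 1"] alt_prod_eq_alt[of False "2 * k + 1"] braid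
  by (cases b) (simp_all add: \<Omega>_def)

lemma \<Omega>_closed [simp]: "\<Omega> \<in> carrier G"
  by (simp add: \<Omega>_eq_alt[of True])

text \<open>Both sides are the alternating product of length 2 k + 2 that starts with
  \<open>\<not> b\<close>. As \<open>\<Omega>\<close> has odd length, moving it past a letter swaps
  s and t.\<close>

lemma \<Omega>_letter: "\<Omega> \<otimes> letter b = letter (\<not> b) \<otimes> \<Omega>"
proof -
  have "\<Omega> \<otimes> letter b = alt (\<not> b) (Suc (2 * k + 1))"
    by (subst alt_Suc_right) (simp add: \<Omega>_eq_alt[of "\<not> b"])
  also have "\<dots> = letter (\<not> b) \<otimes> alt b (2 * k + 1)"
    by (subst alt_Suc) simp
  finally show ?thesis by (simp only: \<Omega>_eq_alt[of b])
qed

lemma \<Omega>_ev: "\<Omega> \<otimes> ev w = ev (map Not w) \<otimes> \<Omega>"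
proof (induction w)
  case (Cons b w)
  have "\<Omega> \<otimes> ev (b # w) = letter (\<not> b) \<otimes> (\<Omega> \<otimes> ev w)"
    by (simp add: m_assoc[symmetric] \<Omega>_letter)
  then show ?case by (simp add: Cons m_assoc)
qed simp

lemma \<Omega>_alt: "\<Omega> \<otimes> alt b n = alt (\<not> b) n \<otimes> \<Omega>"
  by (simp add: alt_def \<Omega>_ev map_Not_alt_word)

lemma \<theta>_closed [simp]: "\<theta> \<in> carrier G"
  by (simp add: \<theta>_def)

lemma \<Delta>_closed [simp]: "\<Delta> \<in> carrier G"
  by (simp add: \<Delta>_def)

lemma \<Omega>_factor: "\<Omega> = alt False (2 * k) \<otimes> t"
proof -
  have "alt False (Suc (2 * k)) = alt False (2 * k) \<otimes> t"
    by (subst alt_Suc_right) simp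
  then show ?thesis using \<Omega>_eq_alt[of False] by (simp only: Suc_eq_plus1)
qed

text \<open>Write the second \<open>\<Omega>\<close> as (ts)^k t. The first one moves past (ts)^k,
  which turns into (st)^k, and is then factored in the same way.\<close>

lemma \<Delta>_eq: "\<Delta> = \<theta> \<otimes> t [^] (2::nat)"
proof -
  have "\<Delta> = \<Omega> \<otimes> \<Omega>"
    by (simp add: \<Delta>_def numeral_2_eq_2)
  then have "\<Delta> = \<Omega> \<otimes> (alt False (2 * k) \<otimes> t)"
    by (simp only: \<Omega>_factor[symmetric])
  also have "\<dots> = alt True (2 * k) \<otimes> \<Omega> \<otimes> t"
    using \<Omega>_alt[of False "2 * k"] by (simp add: m_assoc[symmetric])
  also have "\<dots> = \<theta> \<otimes> t [^] (2::nat)"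
    by (subst \<Omega>_factor) (simp add: \<theta>_def numeral_2_eq_2 m_assoc)
  finally show ?thesis .
qed

lemma garside_theta_eq: "garside_theta G \<Delta> (t [^] (2::nat)) = \<theta>"
  by (simp add: garside_theta_def \<Delta>_eq m_assoc)

lemma \<Omega>_in_M: "\<Omega> \<in> M"
  unfolding \<Omega>_eq_alt[of True] alt_def by (rule ev_in_M)

lemma \<Delta>_in_M: "\<Delta> \<in> M"
  by (simp add: \<Delta>_def pow_in_M \<Omega>_in_M)

section \<open>The length homomorphism\<close>

lemma len_one [simp]: "len \<one> = 0"
  using len_mult[of \<one> \<one>] by simp

lemma len_inv: "x \<in> carrier G \<Longrightarrow> len (inv x) = - len x"
  using len_mult[of x "inv x"] by simp

lemma len_letter [simp]: "len (letter b) = 1"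
  by (simp add: letter_def)

lemma len_ev: "len (ev w) = int (length w)"
  by (induction w) (auto simp: len_mult)

lemma len_nonneg: "a \<in> M \<Longrightarrow> 0 \<le> len a"
  by (auto simp: M_eq len_ev)

lemma len_zero: "a \<in> M \<Longrightarrow> len a = 0 \<Longrightarrow> a = \<one>"
  by (auto simp: M_eq len_ev)

lemma len_pow: "x \<in> carrier G \<Longrightarrow> len (x [^] (n::nat)) = int n * len x"
  by (induction n) (auto simp: len_mult distrib_right)

section \<open>Tails and alternating forms\<close>

abbreviation rdiv :: "bool \<Rightarrow> 'a \<Rightarrow> bool" where
  "rdiv b a \<equiv> le_R G M (letter b) a"

lemma rdiv_mult_letter: "a \<in> M \<Longrightarrow> rdiv b (a \<otimes> letter b)"
  by (simp add: le_R_def m_assoc M_closed)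

lemma rdivE:
  assumes "rdiv b a" "a \<in> M"
  obtains a' where "a' \<in> M" "a = a' \<otimes> letter b"
  using assms by (intro that[of "a \<otimes> inv (letter b)"]) (auto simp: le_R_def m_assoc M_closed)

lemma rdiv_left_mult:
  assumes "rdiv b a" "a \<in> M" "c \<in> M"
  shows "rdiv b (c \<otimes> a)"
  using assms by (elim rdivE) (auto simp: m_assoc[symmetric] M_closed intro!: rdiv_mult_letter M_mult)

lemma rdiv_pow:
  assumes "a \<in> M" "a \<otimes> inv (letter b [^] Suc n) \<in> M"
  shows "rdiv b a"
proof -
  let ?c = "a \<otimes> inv (letter b [^] Suc n)"
  have "a = ?c \<otimes> (letter b [^] n \<otimes> letter b)"
    using assms by (simp add: m_assoc M_closed)
  also have "\<dots> = ?c \<otimes> letter b [^] n \<otimes> letter b"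
    using assms by (simp add: m_assoc M_closed)
  finally show ?thesis
    using assms rdiv_mult_letter[of "?c \<otimes> letter b [^] n" b] by (simp add: M_mult pow_in_M)
qed

text \<open>Each letter stripped from the right lowers the length, which is nonnegative on
  \<open>M\<close>.\<close>

lemma exists_pow_factor:
  assumes "a \<in> M"
  obtains a' n where "a' \<in> M" "a = a' \<otimes> letter b [^] (n::nat)" "\<not> rdiv b a'"
  using assms
proof (induction "nat (len a)" arbitrary: a thesis rule: less_induct)
  case less
  show ?case
  proof (cases "rdiv b a")
    case True
    then obtain c where c: "c \<in> M" "a = c \<otimes> letter b" using less.prems(2) by (elim rdivE)
    then have "nat (len c) < nat (len a)"
      using len_nonneg[of c] by (simp add: len_mult M_closed)
    from less.hyps[OF this _ c(1)] obtain a' n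
      where "a' \<in> M" "c = a' \<otimes> letter b [^] (n::nat)" "\<not> rdiv b a'" by blast
    with c show ?thesis
      by (intro less.prems(1)[of a' "Suc n"]) (auto simp: m_assoc M_closed)
  next
    case False
    then show ?thesis using less.prems by (intro less.prems(1)[of a 0]) (auto simp: M_closed)
  qed
qed

text \<open>If i > j, cancelling \<open>letter b [^] j\<close> would leave \<open>a\<close>
  divisible by a positive power of the letter.\<close>

lemma le_R_pow_iff:
  assumes "a \<in> M" "\<not> rdiv b a"
  shows "le_R G M (letter b [^] (i::nat)) (a \<otimes> letter b [^] (j::nat)) \<longleftrightarrow> i \<le> j"
proof
  assume le: "i \<le> j"
  then have "letter b [^] j = letter b [^] (j - i) \<otimes> letter b [^] i"
    by (simp add: nat_pow_mult)
  then have "a \<otimes> letter b [^] j \<otimes> inv (letter b [^] i) = a \<otimes> letter b [^] (j - i)"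
    using assms by (simp add: m_assoc M_closed)
  then show "le_R G M (letter b [^] i) (a \<otimes> letter b [^] j)"
    using assms by (simp add: le_R_def M_mult pow_in_M)
next
  assume le: "le_R G M (letter b [^] i) (a \<otimes> letter b [^] j)"
  show "i \<le> j"
  proof (rule ccontr)
    assume "\<not> i \<le> j"
    then obtain n where i: "i = Suc n + j"
      by (metis add.commute add_Suc_right less_imp_Suc_add not_le)
    have "letter b [^] i = letter b [^] Suc n \<otimes> letter b [^] j"
      unfolding i by (rule nat_pow_mult[symmetric]) simp
    then have "inv (letter b [^] i) = inv (letter b [^] j) \<otimes> inv (letter b [^] Suc n)"
      by (simp add: inv_mult_group del: nat_pow_Suc)
    then have "a \<otimes> letter b [^] j \<otimes> inv (letter b [^] i)
        = a \<otimes> (letter b [^] j \<otimes> inv (letter b [^] j)) \<otimes> inv (letter b [^] Suc n)"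
      using assms by (simp only: m_assoc M_closed nat_pow_closed letter_simps inv_closed m_closed)
    with le have "a \<otimes> inv (letter b [^] Suc n) \<in> M"
      using assms by (simp add: le_R_def M_closed del: nat_pow_Suc)
    then show False using rdiv_pow assms by blast
  qed
qed

lemma not_rdiv_one: "\<not> rdiv b \<one>"
  using len_nonneg[of "inv (letter b)"] by (auto simp: le_R_def len_inv)

text \<open>Divisors among the powers are determined by their exponents, so equal divisor sets force
  equal exponents; this evaluates the definite description in \<open>tail\<close>.\<close>

lemma tail_eq:
  assumes "a \<in> M" "\<not> rdiv b a"
  shows "tail G M (powers b) (a \<otimes> letter b [^] (j::nat)) = letter b [^] j"
  unfolding tail_def
proof (rule the_equality)
  have eq: "({c \<in> powers b. le_R G M c (a \<otimes> letter b [^] j)} = {c \<in> powers b. le_R G M c (letter b [^] l)})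
      \<longleftrightarrow> (\<forall>i. i \<le> j \<longleftrightarrow> i \<le> l)" for l :: nat
  proof -
    have "le_R G M (letter b [^] i) (a \<otimes> letter b [^] j) \<longleftrightarrow> i \<le> j"
      "le_R G M (letter b [^] i) (letter b [^] l) \<longleftrightarrow> i \<le> l" for i :: nat
      using le_R_pow_iff[OF assms, of i j] le_R_pow_iff[OF one_in_M not_rdiv_one, of b i l] by simp_all
    then show ?thesis unfolding powers_def by (simp add: set_eq_iff image_iff) blast
  qed
  show "letter b [^] j \<in> powers b \<and>
    {c \<in> powers b. le_R G M c (a \<otimes> letter b [^] j)} = {c \<in> powers b. le_R G M c (letter b [^] j)}"
    unfolding eq by (auto simp: powers_def)
  fix c
  assume c: "c \<in> powers b \<and>
    {d \<in> powers b. le_R G M d (a \<otimes> letter b [^] j)} = {d \<in> powers b. le_R G M d c}"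
  then obtain l :: nat where l: "c = letter b [^] l" unfolding powers_def by blast
  with c have "\<forall>i. i \<le> j \<longleftrightarrow> i \<le> l" unfolding l eq by blast
  then have "l = j" by (metis order.antisym order.refl)
  then show "c = letter b [^] j" using l by simp
qed

section \<open>Alternating forms with an arbitrary first index\<close>

definition segment :: "nat \<Rightarrow> nat \<Rightarrow> (nat \<Rightarrow> 'a) \<Rightarrow> 'a" where
  "segment q p f = list_prod G (map f (rev [q..<Suc p]))"

text \<open>Numbering the factors from q instead of 1 makes the removal of the rightmost factor stay
  within the same notion, with the parity of each index preserved.\<close>

definition form_from :: "nat \<Rightarrow> 'a \<Rightarrow> nat \<Rightarrow> (nat \<Rightarrow> 'a) \<Rightarrow> bool" where
  "form_from q a p f \<longleftrightarrow> q \<le> p \<and> (\<forall>i\<in>{q..p}. f i \<in> M) \<and> a = segment q p f \<and> f p \<noteq> \<one> \<and>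
    (\<forall>i\<in>{q..p}. f i = tail G M (powers (even i)) (segment i p f))"

lemma alternating_form_iff:
  "alternating_form G M (powers True) (powers False) a p f \<longleftrightarrow> form_from 1 a p f"
proof -
  have "(if odd i then powers False else powers True) = powers (even i)" for i :: nat
    by simp
  then show ?thesis
    unfolding alternating_form_def form_from_def segment_def by (simp only:)
qed

lemma list_prod_in_M: "set xs \<subseteq> M \<Longrightarrow> list_prod G xs \<in> M"
  by (induction xs) (auto intro: M_mult)

lemma segment_in_M: "\<forall>i\<in>{q..p}. f i \<in> M \<Longrightarrow> segment q p f \<in> M"
  unfolding segment_def by (rule list_prod_in_M) auto

lemma segment_Suc:
  assumes "q \<le> p" "\<forall>i\<in>{q..p}. f i \<in> M"
  shows "segment q p f = segment (Suc q) p f \<otimes> f q"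
proof -
  have "[q..<Suc p] = q # [Suc q..<Suc p]" using assms(1) by (simp add: upt_conv_Cons)
  then show ?thesis
    using assms unfolding segment_def
    by (simp only: rev.simps map_append) (subst list_prod_append, auto simp del: upt_Suc simp: M_closed)
qed

lemma segment_cong: "(\<And>i. q \<le> i \<Longrightarrow> i \<le> p \<Longrightarrow> f i = g i) \<Longrightarrow> segment q p f = segment q p g"
  unfolding segment_def by (intro arg_cong[of _ _ "list_prod G"] map_cong) auto

lemma form_from_Suc_iff:
  assumes "q < p"
  shows "form_from q a p f \<longleftrightarrow>
    (\<exists>a'. form_from (Suc q) a' p f \<and> f q \<in> M \<and> a = a' \<otimes> f q \<and> f q = tail G M (powers (even q)) a)"
proof -
  have iv: "{q..p} = insert q {Suc q..p}" using assms by auto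
  show ?thesis
    using assms segment_Suc[of q p f] unfolding form_from_def iv by auto
qed

lemma form_from_single:
  "form_from p a p f \<longleftrightarrow> f p = a \<and> a \<in> M \<and> a \<noteq> \<one> \<and> a = tail G M (powers (even p)) a"
  using M_closed by (auto simp: form_from_def segment_def)

lemma form_from_in_M: "form_from q a p f \<Longrightarrow> a \<in> M"
  by (auto simp: form_from_def segment_in_M)

lemma form_from_not_one:
  assumes "form_from q a p f"
  shows "a \<noteq> \<one>"
  using assms
proof (induction "p - q" arbitrary: a q)
  case 0
  then have "q = p" by (simp add: form_from_def)
  with 0 show ?case by (auto simp: form_from_single)
next
  case (Suc n)
  then have "q < p" by simp
  with Suc.prems obtain a' where a': "form_from (Suc q) a' p f" "f q \<in> M" "a = a' \<otimes> f q"
    by (auto simp: form_from_Suc_iff)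
  have "a' \<noteq> \<one>" using Suc.hyps(1)[of "Suc q" a'] Suc.hyps(2) a'(1) by simp
  then have "len a' > 0"
    using len_nonneg len_zero form_from_in_M[OF a'(1)] by (metis order_le_less)
  then have "len a > 0"
    using a' len_nonneg form_from_in_M[OF a'(1)] by (simp add: len_mult M_closed add_pos_nonneg)
  then show ?case by auto
qed

text \<open>The rightmost factor is a tail of \<open>a\<close>, hence common to both forms, and
  cancels.\<close>

lemma form_from_unique:
  assumes "form_from q a p f" "form_from q a p' f'"
  shows "p = p'"
  using assms
proof (induction "p - q" arbitrary: a q p f p' f' rule: less_induct)
  case less
  \<comment> \<open>A form with the single index r has \<open>a\<close> itself as its tail, so a
    longer form would have remaining product 1, against \<open>form_from_not_one\<close>.\<close>
  have top: False if "form_from r a r g" "form_from r a r' g'" "r \<noteq> r'" for r r' g g'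
  proof -
    have "r < r'" using that by (auto simp: form_from_def)
    with that(2) obtain a' where a': "form_from (Suc r) a' r' g'" "g' r \<in> M" "a = a' \<otimes> g' r"
        "g' r = tail G M (powers (even r)) a"
      unfolding form_from_Suc_iff[OF \<open>r < r'\<close>] by blast
    moreover have "g' r = a" using a'(4) that(1) by (simp add: form_from_single)
    ultimately have "a' = \<one>"
      using form_from_in_M[OF a'(1)] M_closed r_cancel_one by metis
    then show False using form_from_not_one[OF a'(1)] by simp
  qed
  show ?case
  proof (cases "q < p \<and> q < p'")
    case True
    then obtain b b' where
      b: "form_from (Suc q) b p f" "f q \<in> M" "a = b \<otimes> f q" "f q = tail G M (powers (even q)) a" and
      b': "form_from (Suc q) b' p' f'" "f' q \<in> M" "a = b' \<otimes> f' q" "f' q = tail G M (powers (even q)) a"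
      using less.prems True form_from_Suc_iff[of q p a f] form_from_Suc_iff[of q p' a f'] by blast
    then have "b = b'"
      using form_from_in_M M_closed by (metis right_cancel)
    moreover have "p - Suc q < p - q" using True by arith
    ultimately show ?thesis using less.hyps b(1) b'(1) by blast
  next
    case False
    moreover have "q \<le> p" "q \<le> p'" using less.prems by (auto simp: form_from_def)
    ultimately have "q = p \<or> q = p'" by auto
    then show ?thesis using top less.prems by blast
  qed
qed

text \<open>Once the power of \<open>letter (even q)\<close> is split off, non-divisibility by this
  letter is the hypothesis for index q + 1. Since (q - 1) div 2 counts the positive even indices
  below q, the last equation says that each even index contributes one block of letters s.\<close>

lemma exists_form_from:
  assumes "a \<in> M" "a \<noteq> \<one>" "\<not> rdiv (odd q) a" "1 \<le> q"
  shows "\<exists>p f w. form_from q a p f \<and> ev w = a \<and> w \<noteq> [] \<and> last w = even q \<and>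
    true_blocks w + (q - 1) div 2 = p div 2"
  using assms
proof (induction "nat (len a)" arbitrary: a q rule: less_induct)
  case less
  obtain a' n where a': "a' \<in> M" "a = a' \<otimes> letter (even q) [^] (n::nat)" "\<not> rdiv (even q) a'"
    using exists_pow_factor[OF less.prems(1)] by blast
  have tail: "tail G M (powers (even q)) a = letter (even q) [^] n"
    using tail_eq a' by simp
  \<comment> \<open>Otherwise neither letter would divide \<open>a\<close> on the right, although a
    nonempty word has a last letter.\<close>
  have "n \<noteq> 0"
  proof
    assume "n = 0"
    then have nr: "\<not> rdiv b a" for b
      using a' less.prems(3) by (cases "b = even q") (auto simp: M_closed)
    obtain w where "a = ev w" using less.prems(1) by (auto simp: M_eq)
    moreover from this have "w \<noteq> []" using less.prems(2) by auto
    ultimately have "a = ev (butlast w) \<otimes> letter (last w)"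
      using ev_append[of "butlast w" "[last w]"] by simp
    then show False using nr rdiv_mult_letter[of "ev (butlast w)" "last w"] by simp
  qed
  have div: "(if even q then 1 else 0) + (q - 1) div 2 = q div 2"
    using less.prems(4) by (cases q) auto
  show ?case
  proof (cases "a' = \<one>")
    case True
    then have "a = letter (even q) [^] n" using a' by simp
    then have "form_from q a q (\<lambda>_. a)" "ev (replicate n (even q)) = a"
      using less.prems tail by (auto simp: form_from_single ev_replicate)
    moreover have "true_blocks (replicate n (even q)) = (if even q then 1 else 0)"
      using true_blocks_append_replicate[of n "[]" "even q"] \<open>n \<noteq> 0\<close> by simp
    ultimately show ?thesis using div \<open>n \<noteq> 0\<close>
      by (intro exI[of _ q] exI[of _ "\<lambda>_. a"] exI[of _ "replicate n (even q)"]) auto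
  next
    case False
    have "nat (len a') < nat (len a)"
      using a' len_nonneg[OF a'(1)] \<open>n \<noteq> 0\<close> by (simp add: len_mult M_closed len_pow)
    from less.hyps[OF this a'(1) False, of "Suc q"] a'(3) obtain p f w where
      IH: "form_from (Suc q) a' p f" "ev w = a'" "w \<noteq> []" "last w = odd q"
        "true_blocks w + q div 2 = p div 2"
      by auto
    have "q < p" using IH(1) by (auto simp: form_from_def)
    define g where "g = f(q := letter (even q) [^] n)"
    have "segment i p g = segment i p f" if "Suc q \<le> i" for i
      using that by (intro segment_cong) (auto simp: g_def)
    then have "form_from (Suc q) a' p g"
      using IH(1) by (auto simp: form_from_def g_def)
    then have "form_from q a p g"
      using \<open>q < p\<close> a' tail by (auto simp: form_from_Suc_iff g_def intro!: pow_in_M)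
    moreover have "true_blocks (w @ replicate n (even q)) = true_blocks w + (if even q then 1 else 0)"
      using IH \<open>n \<noteq> 0\<close> by (intro true_blocks_append_replicate) auto
    ultimately show ?thesis using IH a' div \<open>n \<noteq> 0\<close>
      by (intro exI[of _ p] exI[of _ g] exI[of _ "w @ replicate n (even q)"])
        (auto simp: ev_append ev_replicate)
  qed
qed

abbreviation dpt :: "'a \<Rightarrow> nat" where
  "dpt \<equiv> depth G M (powers True) (powers False)"

lemma breadth_eq:
  assumes "form_from 1 a p f"
  shows "breadth G M (powers True) (powers False) a = p"
  unfolding breadth_def alternating_form_iff
  using assms form_from_not_one form_from_unique by (auto intro!: the_equality)

lemma depth_eq:
  assumes "form_from 1 a p f"
  shows "dpt a = p div 2"
  unfolding depth_def breadth_eq[OF assms] Let_def by (auto elim!: oddE)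

lemma depth_powers:
  assumes "a \<in> powers False"
  shows "dpt a = 0"
proof (cases "a = \<one>")
  case True
  then show ?thesis by (simp add: depth_def breadth_def)
next
  case False
  obtain n :: nat where n: "a = t [^] n" using assms unfolding powers_def by auto
  then have "tail G M (powers (even (1::nat))) a = a"
    using tail_eq[OF one_in_M not_rdiv_one, of False n] by simp
  then have "form_from 1 a 1 (\<lambda>_. a)"
    using False assms powers_subset_M[of False] by (auto simp: form_from_single)
  then show ?thesis using depth_eq[of a 1] by simp
qed

text \<open>With t^j removed, the form starts at index 2, where (q - 1) div 2 vanishes, so p div 2
  is exactly the number of blocks.\<close>

lemma depth_word:
  assumes "a \<in> M" "a \<notin> powers False"
  obtains w j where "w \<noteq> []" "last w" "\<not> rdiv False (ev w)" "a = ev w \<otimes> t [^] (j::nat)"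
    "dpt a = true_blocks w"
proof -
  obtain v j where v: "v \<in> M" "a = v \<otimes> t [^] (j::nat)" "\<not> rdiv False v"
    using exists_pow_factor[OF assms(1), of False] by auto
  have "v \<noteq> \<one>"
    using v assms(2) by (auto simp: powers_def)
  with exists_form_from[of v 2] v obtain p f w where
    w: "form_from 2 v p f" "ev w = v" "w \<noteq> []" "last w" "true_blocks w = p div 2"
    by auto
  \<comment> \<open>Index 1 is filled with t^j even for j = 0; only the top factor has to differ
    from 1.\<close>
  define g where "g = f(1 := t [^] j)"
  have p: "1 < p" using w(1) by (auto simp: form_from_def)
  have "segment i p g = segment i p f" if "2 \<le> i" for i
    using that by (intro segment_cong) (auto simp: g_def)
  then have "form_from (Suc 1) v p g"
    using w(1) by (auto simp: form_from_def g_def numeral_2_eq_2)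
  moreover have "tail G M (powers (even (1::nat))) a = t [^] j"
    using tail_eq[OF v(1,3)] v(2) by simp
  ultimately have "form_from 1 a p g"
    using p v letter_in_M[of False] by (auto simp: form_from_Suc_iff g_def intro!: pow_in_M)
  then have "dpt a = true_blocks w" using w depth_eq by metis
  with w v show thesis using that by blast
qed

section \<open>Orbits of the base point\<close>

abbreviation m :: real where "m \<equiv> 1 + 2 * real k"

text \<open>The map of t is that of s conjugated by the unit shift, so its arcs are those of s moved
  by 1; s fixes every point m n, and t every point 1 + m n.\<close>

lemma act_s_short:
  fixes n :: int
  assumes "m * of_int n \<le> r" "r < m * of_int n + 1"
  shows "act s r = m * of_int n + 2 * real k * (r - m * of_int n)"
  using half_turn_short[of "2 * k + 1" n r] assms k_pos by (simp add: act_s)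

lemma act_s_long:
  fixes n :: int
  assumes "m * of_int n + 1 \<le> r" "r < m * of_int n + m"
  shows "act s r = m * of_int n + 2 * real k + (r - m * of_int n - 1) / (2 * real k)"
  using half_turn_long[of "2 * k + 1" n r] assms k_pos by (simp add: act_s)

lemma act_t_short:
  fixes n :: int
  assumes "m * of_int n + 1 \<le> r" "r < m * of_int n + 2"
  shows "act t r = m * of_int n + 1 + 2 * real k * (r - m * of_int n - 1)"
  using half_turn_short[of "2 * k + 1" n "r - 1"] assms k_pos by (simp add: act_t algebra_simps)

lemma act_t_long:
  fixes n :: int
  assumes "m * of_int n + 2 \<le> r" "r < m * of_int n + m + 1"
  shows "act t r = m * of_int n + m + (r - m * of_int n - 2) / (2 * real k)"
  using half_turn_long[of "2 * k + 1" n "r - 1"] assms k_pos by (simp add: act_t algebra_simps)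

lemma act_letter_shift: "act (letter b) (r + m * of_int j) = act (letter b) r + m * of_int j"
  using half_turn_shift[of "2 * k + 1" r j] half_turn_shift[of "2 * k + 1" "r - 1" j] k_pos
  by (simp add: letter_def act_s act_t algebra_simps)

lemma act_letter_strict_mono: "strict_mono (act (letter b))"
  using half_turn_strict_mono[of "2 * k + 1"] k_pos
  by (auto simp: strict_mono_def letter_def act_s act_t)

lemma act_shift: "a \<in> M \<Longrightarrow> act a (r + m * of_int j) = act a r + m * of_int j"
proof -
  have "act (ev w) (r + m * of_int j) = act (ev w) r + m * of_int j" for w
    by (induction w) (simp_all add: act_mult act_letter_shift)
  then show "a \<in> M \<Longrightarrow> ?thesis" by (auto simp: M_eq)
qed

lemma act_strict_mono: "a \<in> M \<Longrightarrow> strict_mono (act a)"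
proof -
  have "strict_mono (act (ev w))" for w
    by (induction w) (use act_letter_strict_mono in \<open>simp_all add: strict_mono_def act_mult\<close>)
  then show "a \<in> M \<Longrightarrow> ?thesis" by (auto simp: M_eq)
qed

lemma act_t_pow_1: "act (t [^] (n::nat)) 1 = 1"
proof (induction n)
  case (Suc n)
  have "act t 1 = 1" using act_t_short[of 0 1] by simp
  with Suc show ?case by (simp add: act_mult)
qed simp

section \<open>\<open>\<Omega>\<close> and \<open>\<Delta>\<close> as maps of the line\<close>

lemma act_\<Omega>: "act \<Omega> r = half_turn (2 * k + 1) r + m * (real k - 1)"
proof -
  have m2: "2 \<le> 2 * k + 1" using k_pos by simp
  \<comment> \<open>The two half turns in st make a full turn and the two unit shifts subtract
    2.\<close>
  have st: "act (alt True (2 * n)) r = r + real n * (m - 2)" for n r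
  proof (induction n arbitrary: r)
    case (Suc n)
    have "alt True (2 * Suc n) = s \<otimes> (t \<otimes> alt True (2 * n))"
      by (simp add: alt_Suc)
    then have "act (alt True (2 * Suc n)) r = act s (act t (r + real n * (m - 2)))"
      by (simp add: act_mult Suc)
    also have "\<dots> = r + real n * (m - 2) - 1 + real (2 * k + 1) - 1"
      unfolding act_s act_t half_turn_twice[OF m2] ..
    finally show ?case by (simp add: algebra_simps)
  qed simp
  have "alt True (Suc (2 * k)) = alt True (2 * k) \<otimes> s"
    by (subst alt_Suc_right) simp
  then have "act \<Omega> r = half_turn (2 * k + 1) r - 1 + real k * (m - 2)"
    by (simp add: \<Omega>_eq_alt[of True] act_mult st act_s)
  then show ?thesis by (simp add: algebra_simps)
qed

text \<open>The offset m (k - 1) of \<open>\<Omega>\<close> commutes with the half turn, so the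
  translation length is m + 2 m (k - 1). This is where the constant 2 k - 1 comes from.\<close>

lemma act_\<Delta>: "act \<Delta> r = r + m * (2 * real k - 1)"
proof -
  have m2: "2 \<le> 2 * k + 1" using k_pos by simp
  have "\<Delta> = \<Omega> \<otimes> \<Omega>"
    by (simp add: \<Delta>_def numeral_2_eq_2)
  then have "act \<Delta> r = act \<Omega> (act \<Omega> r)"
    by (simp add: act_mult)
  also have "\<dots> = half_turn (2 * k + 1) (half_turn (2 * k + 1) r + real (2 * k + 1) * of_int (int k - 1))
      + m * (real k - 1)"
    by (simp add: act_\<Omega>)
  also have "\<dots> = r + real (2 * k + 1) + m * of_int (int k - 1) + m * (real k - 1)"
    unfolding half_turn_shift[OF m2] half_turn_twice[OF m2] by simp
  finally show ?thesis by (simp add: algebra_simps)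
qed

lemma act_\<Delta>_pow: "act (\<Delta> [^] (n::nat)) r = r + m * of_int ((2 * int k - 1) * int n)"
  by (induction n arbitrary: r) (simp_all add: act_mult act_\<Delta> algebra_simps)

text \<open>An alternating prefix of length 2 k + 1 evaluates to \<open>\<Omega>\<close>. Moved to
  the right end of the product, with the letters it passes swapped, it can be written as (ts)^k
  t.\<close>

lemma alt_run_le:
  assumes "\<not> rdiv False (ev w)"
  shows "alt_run w \<le> 2 * k"
proof (rule ccontr)
  assume "\<not> alt_run w \<le> 2 * k"
  then have run: "2 * k + 1 \<le> alt_run w" by simp
  then obtain x u where w: "w = x # u" by (cases w) auto
  define v where "v = drop (2 * k + 1) w"
  have "ev w = alt x (2 * k + 1) \<otimes> ev v"
    using take_alt_run[of "2 * k + 1" x u] run append_take_drop_id[of "2 * k + 1" w]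
    by (metis alt_def ev_append v_def w)
  also have "\<dots> = ev (map Not v) \<otimes> alt False (2 * k) \<otimes> t"
    using \<Omega>_ev[of v] \<Omega>_factor \<Omega>_eq_alt[of x] by (simp add: m_assoc)
  finally have "rdiv False (ev w)"
    using rdiv_mult_letter[of "ev (map Not v) \<otimes> alt False (2 * k)" False]
    by (simp add: M_mult alt_def)
  with assms show False by contradiction
qed

lemma \<theta>_pow_Suc: "\<theta> [^] Suc j = \<theta> \<otimes> \<theta> [^] j"
  by (rule nat_pow_Suc2) simp

text \<open>
  The orbit point reached along a word is confined by the first letter \<open>b\<close> of the word, the length
  \<open>i\<close> of its longest alternating prefix and its number \<open>n\<close> of blocks of letters \<open>s\<close>. The left endpoint
  of the confining interval is attained only by the final pieces \<open>staircase b i j\<close> of powers of \<open>\<theta>\<close>.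
\<close>

definition endpoint :: "bool \<Rightarrow> nat \<Rightarrow> nat \<Rightarrow> real" where
  "endpoint b i n = m * real n + (if b then - real i else (2 * real k - real i) / (2 * real k))"

definition located :: "bool \<Rightarrow> nat \<Rightarrow> nat \<Rightarrow> real \<Rightarrow> bool" where
  "located b i n r \<longleftrightarrow> endpoint b i n \<le> r \<and> r < endpoint b i n + (if b then 1 else 1 / (2 * real k))"

context
  fixes i n :: nat and r :: real
  assumes i: "1 \<le> i" "i \<le> 2 * k"
begin

text \<open>First of four transitions, named by the new first letter and then the old one. The arc
  [m (n - 1) + 1, m n) is contracted onto [m n - 1, m n), and the left end of the image comes only
  from the left end of the arc.\<close>

lemma located_s_s:
  assumes "located True i n r"
  shows "located True 1 n (act s r)"
    and "act s r = endpoint True 1 n \<Longrightarrow> i = 2 * k \<and> r = endpoint True i n"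
proof -
  define K where "K = 2 * real k"
  have K: "1 \<le> real i" "real i \<le> K" using i by (simp_all add: K_def flip: of_nat_le_iff)
  \<comment> \<open>The distance of r from the left end of the arc on which s is
    contracting.\<close>
  define d where "d = r - m * real n + K"
  have d: "K - i \<le> d" "d < K - i + 1"
    using assms by (auto simp: located_def endpoint_def d_def)
  have "act s r = m * of_int (int n - 1) + 2 * real k + (r - m * of_int (int n - 1) - 1) / (2 * real k)"
    using d K by (intro act_s_long) (auto simp: d_def K_def algebra_simps)
  then have s: "act s r = m * real n - 1 + d / K"
    by (simp add: d_def K_def algebra_simps)
  have "0 \<le> d / K" "d / K < 1" using d K by auto
  then show "located True 1 n (act s r)"
    by (simp add: located_def endpoint_def s)
  assume "act s r = endpoint True 1 n"
  then have "d = 0" using s K by (simp add: endpoint_def)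
  with d K have "real i = 2 * real k" by (simp add: K_def)
  then show "i = 2 * k \<and> r = endpoint True i n"
    using \<open>d = 0\<close> by (simp add: endpoint_def d_def K_def)
qed

text \<open>The bound \<open>i < 2 * k\<close> keeps r in the contracting arc of t, where a unit
  interval shrinks to length 1 / (2 k).\<close>

lemma located_t_s:
  assumes "located True i n r" "i < 2 * k"
  shows "located False (Suc i) n (act t r)"
    and "act t r = endpoint False (Suc i) n \<Longrightarrow> r = endpoint True i n"
proof -
  define K where "K = 2 * real k"
  have "real (Suc i) \<le> real (2 * k)" using assms(2) by (simp only: of_nat_le_iff)
  with i have K: "1 \<le> real i" "real i + 1 \<le> K" by (simp_all add: K_def)
  define d where "d = r - m * real n + K - 1"
  have d: "K - i - 1 \<le> d" "d < K - i"
    using assms by (auto simp: located_def endpoint_def d_def)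
  have "act t r = m * of_int (int n - 1) + m + (r - m * of_int (int n - 1) - 2) / (2 * real k)"
    using d K by (intro act_t_long) (auto simp: d_def K_def algebra_simps)
  then have t: "act t r = m * real n + d / K"
    by (simp add: d_def K_def algebra_simps)
  have e: "endpoint False (Suc i) n = m * real n + (K - i - 1) / K"
    by (simp add: endpoint_def K_def)
  have "(K - i - 1) / K \<le> d / K" "d / K < (K - i - 1) / K + 1 / K"
    using d K by (auto simp: divide_right_mono simp flip: add_divide_distrib intro!: divide_strict_right_mono)
  then show "located False (Suc i) n (act t r)"
    by (simp add: located_def e t K_def)
  assume "act t r = endpoint False (Suc i) n"
  then have "d = K - i - 1" using t e K by simp
  then show "r = endpoint True i n" by (simp add: endpoint_def d_def)
qed

lemma located_tD:
  assumes "located False i n r"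
  shows "m * real n + (2 * real k - real i) / (2 * real k) \<le> r" "m * real n \<le> r" "r < m * real n + 1"
    "2 * real k - real i \<le> 2 * real k * (r - m * real n)"
    "2 * real k * (r - m * real n) < 2 * real k - real i + 1"
proof -
  define K where "K = 2 * real k"
  have K: "1 \<le> real i" "real i \<le> K" using i by (simp_all add: K_def flip: of_nat_le_iff)
  have r: "(K - i) / K \<le> r - m * real n" "r - m * real n < (K - i) / K + 1 / K"
    using assms by (auto simp: located_def endpoint_def K_def)
  have "0 \<le> (K - i) / K" "(K - i) / K + 1 / K \<le> 1"
    using K by (auto simp: divide_simps)
  with r show "m * real n \<le> r" "r < m * real n + 1" by linarith+
  show "m * real n + (2 * real k - real i) / (2 * real k) \<le> r" using r by (simp add: K_def)
  have "K * ((K - i) / K) \<le> K * (r - m * real n)"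
    using r K by (intro mult_left_mono) auto
  then show "2 * real k - real i \<le> 2 * real k * (r - m * real n)"
    using K by (simp add: K_def)
  have "K * (r - m * real n) < K * ((K - i) / K + 1 / K)"
    using r K by (intro mult_strict_left_mono) auto
  then show "2 * real k * (r - m * real n) < 2 * real k - real i + 1"
    using K by (simp add: K_def distrib_left)
qed

text \<open>Here t contracts [m n, m n + 1) onto its last piece of length 1 / (2 k).\<close>

lemma located_t_t:
  assumes "located False i n r"
  shows "located False 1 n (act t r)"
    and "act t r = endpoint False 1 n \<Longrightarrow> i = 2 * k \<and> r = endpoint False i n"
proof -
  define K where "K = 2 * real k"
  have K: "1 \<le> real i" "real i \<le> K" "2 \<le> K"
    using i k_pos by (simp_all add: K_def flip: of_nat_le_iff)
  have r: "m * real n \<le> r" "r < m * real n + 1" "K - i \<le> K * (r - m * real n)"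
    using located_tD[OF assms] by (simp_all add: K_def)
  have "act t r = m * of_int (int n - 1) + m + (r - m * of_int (int n - 1) - 2) / (2 * real k)"
    using r K by (intro act_t_long) (auto simp: K_def algebra_simps)
  then have t: "act t r = m * real n + (r - m * real n + (K - 1)) / K"
    by (simp add: K_def algebra_simps)
  have "(K - 1) / K \<le> (r - m * real n + (K - 1)) / K" "(r - m * real n + (K - 1)) / K < (K - 1) / K + 1 / K"
    using r K by (auto simp: divide_right_mono simp flip: add_divide_distrib intro!: divide_strict_right_mono)
  then show "located False 1 n (act t r)"
    by (simp add: located_def endpoint_def t K_def)
  assume "act t r = endpoint False 1 n"
  then have "r = m * real n" using t K by (simp add: endpoint_def flip: K_def)
  with r K have "real i = 2 * real k" by (simp add: K_def)
  then show "i = 2 * k \<and> r = endpoint False i n"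
    using \<open>r = m * real n\<close> by (simp add: endpoint_def)
qed

text \<open>The only transition that opens a new block of letters s: the map expands [m n, m n + 1)
  by the factor 2 k, so the short intervals become unit intervals again.\<close>

lemma located_s_t:
  assumes "located False i n r"
  shows "located True (Suc i) (Suc n) (act s r)"
    and "act s r = endpoint True (Suc i) (Suc n) \<Longrightarrow> r = endpoint False i n"
proof -
  note r = located_tD[OF assms]
  have s: "act s r = m * real n + 2 * real k * (r - m * real n)"
    using r act_s_short[of "int n" r] by simp
  have e: "endpoint True (Suc i) (Suc n) = m * real n + (2 * real k - i)"
    by (simp add: endpoint_def algebra_simps)
  show "located True (Suc i) (Suc n) (act s r)"
    unfolding located_def e s using r by simp
  assume "act s r = endpoint True (Suc i) (Suc n)"
  then have "2 * real k * (r - m * real n) = 2 * real k - i" by (simp add: e s)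
  then have "r - m * real n = (2 * real k - i) / (2 * real k)"
    using k_pos by (simp add: eq_divide_eq mult.commute)
  then show "r = endpoint False i n" by (simp add: endpoint_def)
qed

end

text \<open>For i at most 2 k this is a suffix of the word for \<open>\<theta> [^] Suc j\<close>.
  The test \<open>b = odd i\<close> says that \<open>alt b i\<close> ends in s and so is a suffix of
  (ts)^k; otherwise it is a suffix of (st)^k, and the full (ts)^k has to follow.\<close>

definition staircase :: "bool \<Rightarrow> nat \<Rightarrow> nat \<Rightarrow> 'a" where
  "staircase b i j = alt b i \<otimes> (if b = odd i then \<theta> [^] j else alt False (2 * k) \<otimes> \<theta> [^] j)"

lemma staircase_top: "staircase True (2 * k) j = \<theta> [^] Suc j"
  unfolding \<theta>_pow_Suc by (simp add: staircase_def \<theta>_def m_assoc)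

text \<open>Letters are added at the front. Every suffix inherits non-divisibility by t, so
  \<open>alt_run_le\<close> bounds i at each stage and one of the four transitions applies.\<close>

lemma located_word:
  assumes "w \<noteq> []" "last w" "\<not> rdiv False (ev w)"
  shows "located (hd w) (alt_run w) (true_blocks w) (act (ev w) 1) \<and>
    (act (ev w) 1 = endpoint (hd w) (alt_run w) (true_blocks w) \<longrightarrow>
      (\<exists>j. ev w = staircase (hd w) (alt_run w) j))"
  using assms
proof (induction w)
  case Nil
  then show ?case by simp
next
  case (Cons x w)
  show ?case
  proof (cases w)
    case Nil
    with Cons.prems have x: "x" by simp
    \<comment> \<open>A single s sends 1 to 2 k = m - 1, which is the left endpoint for i = n =
      1.\<close>
    have "act s 1 = m * of_int 0 + 2 * real k + (1 - m * of_int 0 - 1) / (2 * real k)"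
      using k_pos by (intro act_s_long) auto
    then have "act (ev (x # w)) 1 = endpoint True 1 1"
      using Nil x by (simp add: endpoint_def)
    moreover have "ev (x # w) = staircase True 1 0"
      using Nil x by (simp add: staircase_def alt_Suc)
    ultimately show ?thesis using Nil x by (auto simp: located_def)
  next
    case (Cons y v)
    define i n where "i = alt_run w" and "n = true_blocks w"
    have hd: "hd w = y" and ne: "w \<noteq> []" using Cons by simp_all
    have nd: "\<not> rdiv False (ev w)"
      using Cons.prems(3) rdiv_left_mult[of False "ev w" "letter x"] by auto
    then have IH: "located y i n (act (ev w) 1)"
        "act (ev w) 1 = endpoint y i n \<Longrightarrow> \<exists>j. ev w = staircase y i j"
      using Cons.IH Cons.prems ne hd by (auto simp: i_def n_def)
    have i: "1 \<le> i" "i \<le> 2 * k" "alt_run (x # w) \<le> 2 * k"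
      using alt_run_pos[OF ne] alt_run_le nd Cons.prems(3) by (auto simp: i_def)
    have act: "act (ev (x # w)) 1 = act (letter x) (act (ev w) 1)"
      by (simp add: act_mult)
    have run: "alt_run (x # w) = (if x = y then 1 else Suc i)"
      using Cons by (simp add: i_def)
    have blocks: "true_blocks (x # w) = (if x \<and> \<not> y then Suc n else n)"
      using Cons by (simp add: n_def)
    let ?r = "act (ev w) 1"
    consider (ss) "x" "y" | (st) "x" "\<not> y" | (ts) "\<not> x" "y" | (tt) "\<not> x" "\<not> y" by blast
    then show ?thesis
    proof cases
      case ss
      have loc: "located True i n ?r" using IH(1) ss by simp
      have "\<exists>j. ev (x # w) = staircase True 1 j" if "act s ?r = endpoint True 1 n"
      proof -
        \<comment> \<open>Repeating s at an endpoint requires a completed power of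
          \<open>\<theta>\<close>; the new s begins the next copy.\<close>
        have "i = 2 * k \<and> ?r = endpoint True i n" using located_s_s(2)[OF i(1,2) loc that] .
        then obtain j where "i = 2 * k" "ev w = staircase True i j" using IH(2) ss by auto
        then have "ev (x # w) = staircase True 1 (Suc j)"
          using ss staircase_top by (simp add: staircase_def alt_Suc)
        then show ?thesis by blast
      qed
      then show ?thesis
        using ss located_s_s(1)[OF i(1,2) loc] unfolding act run blocks by simp
    next
      case st
      have loc: "located False i n ?r" using IH(1) st by simp
      have "\<exists>j. ev (x # w) = staircase True (Suc i) j" if "act s ?r = endpoint True (Suc i) (Suc n)"
      proof -
        have "?r = endpoint False i n" using located_s_t(2)[OF i(1,2) loc that] .
        then obtain j where "ev w = staircase False i j" using IH(2) st by auto
        then have "ev (x # w) = staircase True (Suc i) j"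
          using st by (auto simp: staircase_def alt_Suc m_assoc)
        then show ?thesis by blast
      qed
      then show ?thesis
        using st located_s_t(1)[OF i(1,2) loc] unfolding act run blocks by simp
    next
      case ts
      then have lt: "i < 2 * k" using i run by simp
      have loc: "located True i n ?r" using IH(1) ts by simp
      have "\<exists>j. ev (x # w) = staircase False (Suc i) j" if "act t ?r = endpoint False (Suc i) n"
      proof -
        have "?r = endpoint True i n" using located_t_s(2)[OF i(1,2) loc lt that] .
        then obtain j where "ev w = staircase True i j" using IH(2) ts by auto
        then have "ev (x # w) = staircase False (Suc i) j"
          using ts by (auto simp: staircase_def alt_Suc m_assoc)
        then show ?thesis by blast
      qed
      then show ?thesis
        using ts located_t_s(1)[OF i(1,2) loc lt] unfolding act run blocks by simp
    next
      case tt
      have loc: "located False i n ?r" using IH(1) tt by simp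
      have "\<exists>j. ev (x # w) = staircase False 1 j" if "act t ?r = endpoint False 1 n"
      proof -
        \<comment> \<open>The half (ts)^k of the current copy of \<open>\<theta>\<close> is
          complete, and the new t is the last letter of the other half (st)^k.\<close>
        have "i = 2 * k \<and> ?r = endpoint False i n" using located_t_t(2)[OF i(1,2) loc that] .
        then obtain j where "i = 2 * k" "ev w = staircase False i j" using IH(2) tt by auto
        then have "ev (x # w) = staircase False 1 j"
          using tt by (simp add: staircase_def alt_Suc m_assoc)
        then show ?thesis by blast
      qed
      then show ?thesis
        using tt located_t_t(1)[OF i(1,2) loc] unfolding act run blocks by simp
    qed
  qed
qed

section \<open>Depth and the two conditions\<close>

text \<open>Measured from the base point 1 because t fixes it, so right factors t^j leave the value
  unchanged.\<close>

definition cell :: "'a \<Rightarrow> int" where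
  "cell a = \<lfloor>(act a 1 - 1) / m\<rfloor>"

abbreviation integral :: "'a \<Rightarrow> bool" where
  "integral a \<equiv> act a 1 = 1 + m * of_int (cell a)"

lemma cell_lower: "1 + m * of_int (cell a) \<le> act a 1"
  using floor_divide_lower[of m "act a 1 - 1"] by (simp add: cell_def mult.commute add_pos_nonneg)

lemma cell_upper: "act a 1 < 1 + m * (of_int (cell a) + 1)"
  using floor_divide_upper[of m "act a 1 - 1"] by (simp add: cell_def mult.commute add_pos_nonneg)

lemma cell_eqI:
  assumes "1 + m * of_int n \<le> act a 1" "act a 1 < 1 + m * (of_int n + 1)"
  shows "cell a = n"
  using assms unfolding cell_def floor_eq_iff by (simp add: field_simps add_pos_nonneg)

text \<open>For fixed n the intervals of \<open>located\<close> with i from 1 to 2 k fill [m n - 2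
  k, m n + 1), which is cell n - 1. Its left end belongs to first letter s and i = 2 k, where the
  staircase is a power of \<open>\<theta>\<close>.\<close>

lemma word_cell:
  assumes "w \<noteq> []" "last w" "\<not> rdiv False (ev w)"
  shows "cell (ev w) = int (true_blocks w) - 1"
    and "integral (ev w) \<Longrightarrow> \<exists>j\<ge>1. ev w = \<theta> [^] (j::nat)"
proof -
  let ?i = "alt_run w" and ?n = "true_blocks w" and ?r = "act (ev w) 1"
  have loc: "located (hd w) ?i ?n ?r"
    and stair: "?r = endpoint (hd w) ?i ?n \<Longrightarrow> \<exists>j. ev w = staircase (hd w) ?i j"
    using located_word[OF assms] by auto
  have i: "1 \<le> ?i" "?i \<le> 2 * k"
    using alt_run_pos[OF assms(1)] alt_run_le[OF assms(3)] by auto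
  then have ri: "1 \<le> real ?i" "real ?i \<le> 2 * real k" by linarith+
  have s: "m * ?n - 2 * real k \<le> ?r \<and> ?r < m * ?n" if "hd w"
    using that loc ri by (auto simp: located_def endpoint_def)
  have t: "m * ?n \<le> ?r \<and> ?r < m * ?n + 1" if "\<not> hd w"
  proof -
    have "0 \<le> (2 * real k - ?i) / (2 * real k)" "(2 * real k - ?i) / (2 * real k) + 1 / (2 * real k) \<le> 1"
      using ri k_pos by (auto simp: field_simps)
    then show ?thesis using that loc unfolding located_def endpoint_def by auto
  qed
  have "1 + m * of_int (int ?n - 1) \<le> ?r" "?r < 1 + m * (of_int (int ?n - 1) + 1)"
    using s t k_pos by (cases "hd w"; auto simp: algebra_simps)+
  then show cell: "cell (ev w) = int ?n - 1" by (rule cell_eqI)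
  show "\<exists>j\<ge>1. ev w = \<theta> [^] (j::nat)" if "integral (ev w)"
  proof -
    have r: "?r = m * ?n - 2 * real k" using that unfolding cell by (simp add: algebra_simps)
    have hd: "hd w" using r t k_pos by fastforce
    then have "m * ?n - ?i \<le> ?r" using loc by (simp add: located_def endpoint_def)
    with r i(2) have "?i = 2 * k" by linarith
    with stair hd r obtain j where "ev w = staircase True (2 * k) j"
      by (auto simp: endpoint_def)
    then have "ev w = \<theta> [^] Suc j"
      by (simp only: staircase_top)
    then show ?thesis by (intro exI[of _ "Suc j"]) simp
  qed
qed

lemma act_right_t_pow: "a \<in> M \<Longrightarrow> act (a \<otimes> t [^] (n::nat)) 1 = act a 1"
  by (simp add: act_mult M_closed act_t_pow_1)

abbreviation thetas :: "'a set" where "thetas \<equiv> Theta G \<Delta> (powers False) (t [^] (2::nat))"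
abbreviation thetas_bar :: "'a set" where
  "thetas_bar \<equiv> Theta_bar G \<Delta> (powers False) (t [^] (2::nat))"

lemma thetas_iff: "a \<in> thetas \<longleftrightarrow> (\<exists>(j::nat) (l::nat). 1 \<le> j \<and> a = \<theta> [^] j \<otimes> t [^] l)"
  unfolding Theta_def garside_theta_eq powers_def by auto

lemma thetas_bar_iff: "a \<in> thetas_bar \<longleftrightarrow> a \<in> thetas \<or> a \<in> powers False"
  by (auto simp: Theta_bar_def)

lemma \<theta>_in_M: "\<theta> \<in> M"
  by (simp add: \<theta>_def alt_def M_mult)

lemma act_\<theta>_pow: "act (\<theta> [^] (j::nat)) 1 = 1 + m * of_int ((2 * int k - 1) * int j)"
proof (induction j)
  case (Suc j)
  \<comment> \<open>The two elements differ by the right factor t^2, which fixes 1.\<close>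
  have "act \<theta> 1 = act \<Delta> 1"
    using act_right_t_pow[OF \<theta>_in_M] by (simp add: \<Delta>_eq)
  then have "act \<theta> 1 = 1 + m * (2 * real k - 1)" by (simp add: act_\<Delta>)
  moreover have "act (\<theta> [^] Suc j) 1 = act \<theta> (act (\<theta> [^] j) 1)"
    unfolding \<theta>_pow_Suc by (rule act_mult) simp_all
  ultimately show ?case
    unfolding Suc act_shift[OF \<theta>_in_M] by (simp add: algebra_simps)
qed simp

lemma cell_powers: "a \<in> powers False \<Longrightarrow> cell a = 0 \<and> integral a"
proof -
  have "cell (t [^] n) = 0" for n :: nat
    using act_t_pow_1 by (intro cell_eqI) (auto simp: add_pos_nonneg)
  then show "a \<in> powers False \<Longrightarrow> ?thesis" using act_t_pow_1 by (auto simp: powers_def)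
qed

lemma thetas_cell: "a \<in> thetas \<Longrightarrow> a \<in> M \<and> cell a > 0 \<and> integral a"
proof -
  assume "a \<in> thetas"
  then obtain j l :: nat where a: "1 \<le> j" "a = \<theta> [^] j \<otimes> t [^] l" by (auto simp: thetas_iff)
  have "act a 1 = 1 + m * of_int ((2 * int k - 1) * int j)"
    using a act_right_t_pow[of "\<theta> [^] j" l] act_\<theta>_pow by (simp add: pow_in_M \<theta>_in_M)
  moreover from this have "cell a = (2 * int k - 1) * int j"
    by (intro cell_eqI) (auto simp: algebra_simps add_pos_nonneg)
  moreover have "a \<in> M" using a letter_in_M[of False] by (auto intro!: M_mult pow_in_M \<theta>_in_M)
  ultimately show ?thesis using a k_pos by auto
qed

text \<open>The offset 1 is that of \<open>word_cell\<close>. Powers of t also lie in cell 0 but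
  have depth 0; this exception accounts for the cases of Condition B that involve
  \<open>M\<^sub>1\<close>.\<close>

lemma depth_cell:
  assumes "a \<in> M"
  shows "int (dpt a) = (if a \<in> powers False then 0 else cell a + 1)"
proof (cases "a \<in> powers False")
  case True
  then show ?thesis by (simp only: depth_powers if_True of_nat_0)
next
  case False
  then obtain w j where w: "w \<noteq> []" "last w" "\<not> rdiv False (ev w)" "a = ev w \<otimes> t [^] (j::nat)"
    "dpt a = true_blocks w"
    using depth_word assms by blast
  then have "cell a = cell (ev w)" by (simp add: cell_def act_right_t_pow)
  then show ?thesis using word_cell(1) w False by simp
qed

text \<open>Turns the pairs excluded from Condition B into pairs of integral elements.\<close>

lemma integral_iff:
  assumes "a \<in> M"
  shows "integral a \<longleftrightarrow> a \<in> thetas_bar"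
proof
  assume int: "integral a"
  show "a \<in> thetas_bar"
  proof (cases "a \<in> powers False")
    case False
    then obtain w j where w: "w \<noteq> []" "last w" "\<not> rdiv False (ev w)" "a = ev w \<otimes> t [^] (j::nat)"
      using depth_word assms by blast
    have "integral (ev w)" using int by (simp add: w(4) cell_def act_right_t_pow)
    from word_cell(2)[OF w(1-3) this] obtain i :: nat where i: "1 \<le> i" "ev w = \<theta> [^] i"
      by auto
    have "a \<in> thetas"
      unfolding thetas_iff by (intro exI[of _ i] exI[of _ j] conjI i(1)) (simp only: w(4) i(2))
    then show ?thesis by (simp add: thetas_bar_iff)
  qed (simp add: thetas_bar_iff)
qed (use thetas_cell cell_powers in \<open>auto simp: thetas_bar_iff\<close>)

text \<open>Dividing by \<open>\<Delta>\<close> lowers the length, so the process stops at an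
  unmovable factor. Two different exponents would make \<open>\<Delta>\<close> divide the unmovable
  part that goes with the smaller one.\<close>

lemma Delta_form_eq:
  assumes "a \<in> M"
  obtains c p where "Delta_form G M \<Delta> a = (c, int p)" "c \<in> M" "a = c \<otimes> \<Delta> [^] p"
proof -
  have len_\<Delta>: "len \<Delta> > 0"
    using len_nonneg[of \<theta>] by (simp add: \<Delta>_eq len_mult len_pow \<theta>_in_M)
  have "\<exists>c p. unmovable G M \<Delta> c \<and> a = c \<otimes> \<Delta> [^] (p::nat)"
    using assms
  proof (induction "nat (len a)" arbitrary: a rule: less_induct)
    case less
    show ?case
    proof (cases "unmovable G M \<Delta> a")
      case True
      then show ?thesis using less.prems by (intro exI[of _ a] exI[of _ 0]) (simp add: M_closed)
    next
      case False
      define b where "b = a \<otimes> inv \<Delta>"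
      have b: "b \<in> M" "a = b \<otimes> \<Delta>"
        using False less.prems by (auto simp: unmovable_def le_R_def b_def m_assoc M_closed)
      have "nat (len b) < nat (len a)"
        using b len_\<Delta> len_nonneg[OF b(1)] by (simp add: len_mult M_closed)
      from less.hyps[OF this b(1)] obtain c p where "unmovable G M \<Delta> c" "b = c \<otimes> \<Delta> [^] (p::nat)"
        by auto
      then show ?thesis using b
        by (intro exI[of _ c] exI[of _ "Suc p"]) (auto simp: m_assoc unmovable_def M_closed)
    qed
  qed
  then obtain c p where c: "unmovable G M \<Delta> c" "a = c \<otimes> \<Delta> [^] (p::nat)" by auto
  have le: "i \<le> j" if "unmovable G M \<Delta> d" "unmovable G M \<Delta> e" "d \<otimes> \<Delta> [^] (i::int) = e \<otimes> \<Delta> [^] (j::int)"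
    for d e i j
  proof (rule ccontr)
    assume "\<not> i \<le> j"
    then obtain n where n: "i - j = int n + 1" using zless_iff_Suc_zadd[of j i] by auto
    have de: "d \<in> carrier G" "e \<in> carrier G" using that by (auto simp: unmovable_def M_closed)
    have "e = d \<otimes> \<Delta> [^] i \<otimes> inv (\<Delta> [^] j)" using de that(3) by (simp add: m_assoc)
    also have "\<dots> = d \<otimes> \<Delta> [^] (int n + 1)"
      using de n by (simp add: m_assoc flip: int_pow_diff)
    also have "\<dots> = d \<otimes> \<Delta> [^] n \<otimes> \<Delta>"
      using de by (simp add: int_pow_mult int_pow_int m_assoc)
    finally have "e \<otimes> inv \<Delta> = d \<otimes> \<Delta> [^] n"
      using de by (simp add: m_assoc)
    then show False
      using that by (auto simp: unmovable_def le_R_def M_mult pow_in_M \<Delta>_in_M)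
  qed
  have "Delta_form G M \<Delta> a = (c, int p)"
    unfolding Delta_form_def
  proof (rule the_equality)
    show "case (c, int p) of (d, j) \<Rightarrow> unmovable G M \<Delta> d \<and> a = d \<otimes> \<Delta> [^] j"
      using c by (simp add: int_pow_int)
    fix x :: "'a \<times> int"
    assume "case x of (d, j) \<Rightarrow> unmovable G M \<Delta> d \<and> a = d \<otimes> \<Delta> [^] j"
    then obtain d and j :: int where x: "x = (d, j)" "unmovable G M \<Delta> d" "a = d \<otimes> \<Delta> [^] j" by auto
    have eq: "d \<otimes> \<Delta> [^] j = c \<otimes> \<Delta> [^] int p" using x c by (simp add: int_pow_int)
    then have "j = int p" using le x(2) c(1) by (metis order.antisym)
    with eq show "x = (c, int p)" using x c by (auto simp: unmovable_def M_closed)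
  qed
  with c show thesis using that by (auto simp: unmovable_def)
qed

theorem condition_A: "condition_A (G, M, \<Delta>) (H, powers True, \<Lambda>) (G\<^sub>1, powers False, \<Delta>\<^sub>1) (2 * k - 1)"
proof -
  have "dpt (\<Delta> [^] j) = (2 * k - 1) * j + 1" if "1 \<le> j" for j :: nat
  proof -
    have "act (\<Delta> [^] j) 1 = 1 + m * of_int ((2 * int k - 1) * int j)" by (rule act_\<Delta>_pow)
    then have c: "cell (\<Delta> [^] j) = (2 * int k - 1) * int j"
      by (intro cell_eqI) (auto simp: algebra_simps add_pos_nonneg)
    \<comment> \<open>The cell is positive, whereas powers of t lie in cell 0; hence the depth is
      the cell plus 1.\<close>
    then have "\<Delta> [^] j \<notin> powers False" using cell_powers that k_pos by fastforce
    then have "int (dpt (\<Delta> [^] j)) = (2 * int k - 1) * int j + 1"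
      using depth_cell[of "\<Delta> [^] j"] c by (simp add: pow_in_M \<Delta>_in_M)
    also have "\<dots> = int ((2 * k - 1) * j + 1)"
      using k_pos by (simp add: of_nat_diff)
    finally show ?thesis by (simp only: of_nat_eq_iff)
  qed
  then show ?thesis by simp
qed

section \<open>Cells of products\<close>

lemma cell_mult_integral_right:
  assumes "a \<in> M" "b \<in> M" "integral b"
  shows "cell (a \<otimes> b) = cell a + cell b"
proof -
  have "act (a \<otimes> b) 1 = act a 1 + m * of_int (cell b)"
    using assms act_shift[of a 1 "cell b"] by (simp add: act_mult M_closed)
  then show ?thesis
    using cell_lower[of a] cell_upper[of a] by (intro cell_eqI) (auto simp: algebra_simps)
qed

text \<open>Apply the increasing map of \<open>a\<close> to 1 + m n < act b 1 < 1 + m (n + 1) with n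
  = \<open>cell b\<close>; the outer values become translates of \<open>act a 1\<close>.\<close>

lemma act_mult_bounds:
  assumes "a \<in> M" "b \<in> M" "\<not> integral b"
  shows "act a 1 + m * of_int (cell b) < act (a \<otimes> b) 1"
    and "act (a \<otimes> b) 1 < act a 1 + m * (of_int (cell b) + 1)"
proof -
  have mult: "act (a \<otimes> b) 1 = act a (act b 1)" using assms by (simp add: act_mult M_closed)
  have "1 + m * of_int (cell b) < act b 1" "act b 1 < 1 + m * of_int (cell b + 1)"
    using assms(3) cell_lower[of b] cell_upper[of b] by (auto simp: order_less_le)
  from this[THEN strict_monoD[OF act_strict_mono[OF assms(1)]]]
  show "act a 1 + m * of_int (cell b) < act (a \<otimes> b) 1"
    and "act (a \<otimes> b) 1 < act a 1 + m * (of_int (cell b) + 1)"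
    unfolding act_shift[OF assms(1)] mult by simp_all
qed

lemma cell_mult_integral_left:
  assumes "a \<in> M" "b \<in> M" "integral a" "\<not> integral b"
  shows "cell (a \<otimes> b) = cell a + cell b" "\<not> integral (a \<otimes> b)"
proof -
  have *: "1 + m * of_int (cell a + cell b) < act (a \<otimes> b) 1"
    "act (a \<otimes> b) 1 < 1 + m * (of_int (cell a + cell b) + 1)"
    using act_mult_bounds[OF assms(1,2,4)] assms(3) by (auto simp: algebra_simps)
  then show "cell (a \<otimes> b) = cell a + cell b" by (intro cell_eqI) auto
  with * show "\<not> integral (a \<otimes> b)" by simp
qed

text \<open>The bounds for the product span two cells, and the lower one is strict, so an integral
  product sits at the left end of the second cell.\<close>

lemma cell_mult:
  assumes "a \<in> M" "b \<in> M" "\<not> integral a" "\<not> integral b"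
  shows "cell (a \<otimes> b) \<in> {cell a + cell b, cell a + cell b + 1}"
    and "integral (a \<otimes> b) \<Longrightarrow> cell (a \<otimes> b) = cell a + cell b + 1"
proof -
  let ?n = "cell a + cell b"
  have *: "1 + m * of_int ?n < act (a \<otimes> b) 1"
    "act (a \<otimes> b) 1 < 1 + m * (of_int ?n + 1 + 1)"
    using act_mult_bounds[OF assms(1,2,4)] cell_lower[of a] cell_upper[of a]
    by (auto simp: algebra_simps)
  show mem: "cell (a \<otimes> b) \<in> {?n, ?n + 1}"
  proof (cases "act (a \<otimes> b) 1 < 1 + m * (of_int ?n + 1)")
    case True
    then have "cell (a \<otimes> b) = ?n" using * by (intro cell_eqI) auto
    then show ?thesis by simp
  next
    case False
    then have "cell (a \<otimes> b) = ?n + 1" using * by (intro cell_eqI) auto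
    then show ?thesis by simp
  qed
  show "cell (a \<otimes> b) = ?n + 1" if "integral (a \<otimes> b)"
    using mem * that by auto
qed

theorem condition_B:
  "condition_B (G, M, \<Delta>) (H, powers True, \<Lambda>) (G\<^sub>1, powers False, t [^] (2::nat)) (2 * k - 1)"
proof -
  have "\<exists>\<epsilon>::int. \<epsilon> \<in> {0, 1} \<and> int (dpt c) = int (dpt a) + int (dpt b) - int (2 * k - 1) * int p - \<epsilon> \<and>
      (a \<in> thetas \<or> b \<in> thetas \<or> c \<in> powers False \<longrightarrow> \<epsilon> = 1)"
    if a: "a \<in> M" and b: "b \<in> M" and bar: "\<not> (a \<in> thetas_bar \<and> b \<in> thetas_bar)"
      and c: "c \<in> M" "a \<otimes> b = c \<otimes> \<Delta> [^] p" for a b c p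
  proof -
    let ?z = "int (2 * k - 1) * int p"
    have \<Delta>1: "act (\<Delta> [^] p) 1 = 1 + m * of_int ?z"
      unfolding act_\<Delta>_pow using k_pos by (simp add: of_nat_diff)
    then have int: "integral (\<Delta> [^] p)" and "cell (\<Delta> [^] p) = ?z"
      using cell_eqI[of ?z "\<Delta> [^] p"] by (auto simp: algebra_simps add_pos_nonneg)
    then have cell_c: "cell (a \<otimes> b) = cell c + ?z"
      using cell_mult_integral_right[of c "\<Delta> [^] p"] c by (simp add: pow_in_M \<Delta>_in_M)
    have int_c: "integral c \<longleftrightarrow> integral (a \<otimes> b)"
      using cell_c c act_shift[OF c(1), of 1 ?z] \<Delta>1
      by (simp add: act_mult M_closed algebra_simps)
    have in_thetas: "x \<in> thetas \<Longrightarrow> integral x \<and> x \<notin> powers False" for x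
      using thetas_cell[of x] cell_powers[of x] by auto
    note depth = depth_cell[OF a] depth_cell[OF b] depth_cell[OF c(1)]
    note bars = integral_iff[OF a] integral_iff[OF b] thetas_bar_iff
    \<comment> \<open>By \<open>integral_iff\<close> the excluded pairs are exactly those with both
      factors integral.\<close>
    consider (l) "integral a" "\<not> integral b" | (r) "\<not> integral a" "integral b"
      | (n) "\<not> integral a" "\<not> integral b"
      using bar bars by blast
    then show ?thesis
    proof cases
      case l
      have "b \<notin> powers False" "b \<notin> thetas" "c \<notin> powers False"
        using l cell_mult_integral_left[OF a b l] int_c cell_powers in_thetas by blast+
      then show ?thesis
        using cell_mult_integral_left(1)[OF a b l] cell_c in_thetas[of a] cell_powers[of a] depth
        \<comment> \<open>Cells add exactly. A factor in \<open>\<Theta>\<close> has depth one more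
          than its cell and costs 1; a power of t has depth and cell 0 and costs nothing.\<close>
        by (intro exI[of _ "if a \<in> powers False then 0 else 1"]) auto
    next
      case r
      have "\<not> integral (a \<otimes> b)"
      proof -
        have "act (a \<otimes> b) 1 = act a 1 + m * of_int (cell b)"
          using act_shift[OF a, of 1 "cell b"] a b r(2) by (simp add: act_mult M_closed)
        then show ?thesis
          using r(1) cell_mult_integral_right[OF a b r(2)] by (simp add: algebra_simps)
      qed
      then have "a \<notin> powers False" "a \<notin> thetas" "c \<notin> powers False"
        using r int_c cell_powers in_thetas by blast+
      then show ?thesis
        using cell_mult_integral_right[OF a b r(2)] cell_c in_thetas[of b] cell_powers[of b] depth
        by (intro exI[of _ "if b \<in> powers False then 0 else 1"]) auto
    next
      case n
      have not: "a \<notin> powers False" "a \<notin> thetas" "b \<notin> powers False" "b \<notin> thetas"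
        using n cell_powers in_thetas by blast+
      show ?thesis
      proof (cases "c \<in> powers False")
        case True
        \<comment> \<open>An integral product carries 1, which offsets the missing 1 in the depth of
          c and makes \<open>\<epsilon>\<close> equal to 1.\<close>
        then have "cell (a \<otimes> b) = cell a + cell b + 1"
          using cell_mult(2)[OF a b n] int_c cell_powers by blast
        then show ?thesis using True cell_c not depth cell_powers[of c]
          by (intro exI[of _ 1]) auto
      next
        case False
        then show ?thesis using cell_mult(1)[OF a b n] cell_c not depth
          \<comment> \<open>All three depths exceed the cells by 1, so \<open>\<epsilon>\<close> is
            1 minus the carry.\<close>
          by (intro exI[of _ "cell a + cell b + 1 - cell (a \<otimes> b)"]) auto
      qed
    qed
  qed
  note key = this
  have "let (c, p) = Delta_form G M \<Delta> (a \<otimes> b) in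
        \<exists>\<epsilon>::int. \<epsilon> \<in> {0, 1} \<and>
          int (dpt c) = int (dpt a) + int (dpt b) - int (2 * k - 1) * p - \<epsilon> \<and>
          (a \<in> thetas \<or> b \<in> thetas \<or> c \<in> powers False \<longrightarrow> \<epsilon> = 1)"
    if ab: "a \<in> M" "b \<in> M" "\<not> (a \<in> thetas_bar \<and> b \<in> thetas_bar)" for a b
  proof -
    obtain c p where c: "Delta_form G M \<Delta> (a \<otimes> b) = (c, int p)" "c \<in> M" "a \<otimes> b = c \<otimes> \<Delta> [^] p"
      using Delta_form_eq[OF M_mult[OF ab(1,2)]] by blast
    show ?thesis
      unfolding c(1) Let_def prod.case by (rule key) (use ab c in auto)
  qed
  then show ?thesis
    unfolding condition_B.simps by (intro ballI case_prodI2 impI) blast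
qed

end

section \<open>The Artin group\<close>

text \<open>The inverse of the half turn is the half turn followed by translation by - m, which
  gives the two branches for inverse letters.\<close>

definition artin_move :: "nat \<Rightarrow> artin_gen \<times> bool \<Rightarrow> real \<Rightarrow> real" where
  "artin_move m = (\<lambda>(x, e) r. case x of
      Gen_s \<Rightarrow> if e then half_turn m r - 1 else half_turn m (r + 1) - m
    | Gen_t \<Rightarrow> if e then half_turn m (r - 1) else half_turn m r - m + 1)"

definition artin_count :: "artin_gen \<times> bool \<Rightarrow> int \<Rightarrow> int" where
  "artin_count = (\<lambda>(x, e) n. if e then n + 1 else n - 1)"

lemma artin_move_cancel:
  assumes "2 \<le> m"
  shows "artin_move m (x, e) (artin_move m (x, \<not> e) r) = r"
proof -
  have "half_turn m (q - m) = half_turn m q - m" for q :: real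
    using half_turn_shift[OF assms, of q "-1"] by simp
  moreover have "half_turn m (half_turn m q - real m + 1 - 1) = q" for q
    using half_turn_shift[OF assms, of "half_turn m q" "-1"] half_turn_twice[OF assms] by simp
  ultimately show ?thesis
    using half_turn_twice[OF assms] by (cases x; cases e) (simp_all add: artin_move_def)
qed

text \<open>Since st translates by m - 2, (st)^k s and t (st)^k apply the half turn with total shift
  k (m - 2) - 1 after and before it. For m = 2 k + 1 this shift is m (k - 1), a multiple of the
  period, so it commutes with the half turn.\<close>

lemma foldr_artin_move_alt_word:
  assumes "1 \<le> k" and m: "m = 2 * k + 1"
  shows "foldr (artin_move m) (alt_word (Gen_s, True) (Gen_t, True) m) =
    foldr (artin_move m) (alt_word (Gen_t, True) (Gen_s, True) m)"
proof
  fix r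
  have m2: "2 \<le> m" using assms by simp
  let ?w = "alt_word (Gen_s, True) (Gen_t, True)"
  have st: "foldr (artin_move m) (?w (2 * n)) q = q + real n * (real m - 2)" for n q
    by (induction n) (simp_all add: artin_move_def half_turn_twice[OF m2] algebra_simps)
  have "alt_word x y (Suc (2 * n)) = alt_word x y (2 * n) @ [x]" for x y :: "artin_gen \<times> bool" and n
    by (induction n) simp_all
  then have "foldr (artin_move m) (?w m) r = half_turn m r - 1 + real k * (real m - 2)"
    using st[of k] by (simp add: m artin_move_def)
  also have "\<dots> = half_turn m r + real m * of_int (int k - 1)"
    by (simp add: m algebra_simps)
  also have "\<dots> = half_turn m (r + real k * (real m - 2) - 1)"
    unfolding half_turn_shift[OF m2, symmetric] by (simp add: m algebra_simps)
  also have "\<dots> = foldr (artin_move m) (alt_word (Gen_t, True) (Gen_s, True) m) r"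
    using st[of k] by (simp add: m artin_move_def)
  finally show "foldr (artin_move m) (?w m) r =
    foldr (artin_move m) (alt_word (Gen_t, True) (Gen_s, True) m) r" .
qed

lemma foldr_artin_count_alt_word:
  "foldr artin_count (alt_word (x, True) (y, True) n) i = i + int n"
  by (induction n arbitrary: x y) (simp_all add: artin_count_def)

text \<open>Words act on the integers by translations, so composing them adds their values at 0;
  this makes the exponent sum a homomorphism.\<close>

lemma foldr_artin_count: "foldr artin_count u i = i + foldr artin_count u 0"
proof (induction u)
  case (Cons a u)
  have "artin_count a (i + n) = i + artin_count a n" for n
    by (simp add: artin_count_def split: prod.split)
  then show ?case using Cons.IH by simp
qed simp

lemma dihedral_action_artin_I2:
  assumes "1 \<le> k" and m: "m = 2 * k + 1"
  defines "R \<equiv> artin_I2_rels m"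
  shows "dihedral_action (artin_I2 m) (artin_s m) (artin_t m) k
    (class_act R (artin_move m)) (\<lambda>a. class_act R artin_count a 0)"
proof -
  have m2: "2 \<le> m" using assms by simp
  interpret group "artin_I2 m"
    unfolding artin_I2_def by (rule group_presented_group)
  have G: "artin_I2 m = presented_group R"
    by (simp add: artin_I2_def R_def)
  have rel: "u = alt_word (Gen_s, True) (Gen_t, True) m \<and> v = alt_word (Gen_t, True) (Gen_s, True) m"
    if "(u, v) \<in> R" for u v
    using that by (simp add: R_def artin_I2_rels_def)
  have move_rel: "foldr (artin_move m) u = foldr (artin_move m) v" if "(u, v) \<in> R" for u v
    using rel[OF that] foldr_artin_move_alt_word[OF assms(1,2)] by simp
  have count_cancel: "artin_count (x, e) (artin_count (x, \<not> e) i) = i" for x e i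
    by (simp add: artin_count_def)
  have count_rel: "foldr artin_count u = foldr artin_count v" if "(u, v) \<in> R" for u v
    using rel[OF that] by (auto simp: foldr_artin_count_alt_word)
  note move = artin_move_cancel[OF m2] move_rel
  note count = count_cancel count_rel
  have in_carrier: "pres_class R u \<in> carrier (artin_I2 m)" for u
    by (simp add: G presented_group_def)
  have st: "artin_s m = pres_class R [(Gen_s, True)]" "artin_t m = pres_class R [(Gen_t, True)]"
    by (simp_all add: artin_s_def artin_t_def pres_gen_def R_def)
  have alt: "alt_prod (artin_I2 m) (pres_class R [x]) (pres_class R [y]) n = pres_class R (alt_word x y n)"
    for x y n
  proof (induction n arbitrary: x y)
    case 0
    show ?case by (simp add: alt_prod_def) (simp add: G presented_group_def)
  next
    case (Suc n)
    have "alt_prod (artin_I2 m) (pres_class R [x]) (pres_class R [y]) (Suc n) =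
        pres_class R [x] \<otimes>\<^bsub>artin_I2 m\<^esub> alt_prod (artin_I2 m) (pres_class R [y]) (pres_class R [x]) n"
      by (simp add: alt_prod_def)
    then show ?case unfolding Suc.IH unfolding G mult_pres_class by simp
  qed
  show ?thesis
  proof
    show "1 \<le> k" by fact
    show "artin_s m \<in> carrier (artin_I2 m)" "artin_t m \<in> carrier (artin_I2 m)"
      unfolding st by (rule in_carrier)+
    show "alt_prod (artin_I2 m) (artin_s m) (artin_t m) (2 * k + 1) =
        alt_prod (artin_I2 m) (artin_t m) (artin_s m) (2 * k + 1)"
      unfolding st alt pres_class_eq_iff
      by (rule pres_eq.rel) (simp add: R_def artin_I2_rels_def m)
    show "class_act R (artin_move m) \<one>\<^bsub>artin_I2 m\<^esub> r = r" for r
      unfolding G by (rule class_act_one[OF move])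
    show "class_act R (artin_move m) (x \<otimes>\<^bsub>artin_I2 m\<^esub> y) r =
        class_act R (artin_move m) x (class_act R (artin_move m) y r)"
      if "x \<in> carrier (artin_I2 m)" "y \<in> carrier (artin_I2 m)" for x y r
      using that unfolding G by (intro class_act_mult[OF move])
    show "class_act R (artin_move m) (artin_s m) r = half_turn (2 * k + 1) r - 1" for r
      unfolding st by (subst class_act_pres_class[OF move]) (simp_all add: artin_move_def m)
    show "class_act R (artin_move m) (artin_t m) r = half_turn (2 * k + 1) (r - 1)" for r
      unfolding st by (subst class_act_pres_class[OF move]) (simp_all add: artin_move_def m)
    show "class_act R artin_count (x \<otimes>\<^bsub>artin_I2 m\<^esub> y) 0 =
        class_act R artin_count x 0 + class_act R artin_count y 0"
      if "x \<in> carrier (artin_I2 m)" "y \<in> carrier (artin_I2 m)" for x y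
    proof -
      have "class_act R artin_count x (class_act R artin_count y 0) =
          class_act R artin_count y 0 + class_act R artin_count x 0"
        unfolding class_act_def by (rule foldr_artin_count)
      moreover have "class_act R artin_count (x \<otimes>\<^bsub>artin_I2 m\<^esub> y) 0 =
          class_act R artin_count x (class_act R artin_count y 0)"
        using that unfolding G by (intro class_act_mult[OF count])
      ultimately show ?thesis by simp
    qed
    show "class_act R artin_count (artin_s m) 0 = 1"
      unfolding st by (subst class_act_pres_class[OF count]) (simp_all add: artin_count_def)
    show "class_act R artin_count (artin_t m) 0 = 1"
      unfolding st by (subst class_act_pres_class[OF count]) (simp_all add: artin_count_def)
  qed
qed

theorem theorem6p1:
  fixes k m :: nat
    and G :: "artin_gen gword set monoid"
    and M G\<^sub>1 M\<^sub>1 H N :: "artin_gen gword set set"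
    and s t \<Omega> \<Delta> \<Delta>\<^sub>1 \<Lambda> :: "artin_gen gword set"
  assumes "m = 2 * k + 1" and "m \<ge> 5"
    and "G = artin_I2 m" and "s = artin_s m" and "t = artin_t m"
    and "M = submonoid_generated G {s, t}"
    and "\<Omega> = alt_prod G s t m"
    and "\<Delta> = \<Omega> [^]\<^bsub>G\<^esub> (2::nat)"
    and "G\<^sub>1 = generate G {t}" and "M\<^sub>1 = submonoid_generated G {t}" and "\<Delta>\<^sub>1 = t [^]\<^bsub>G\<^esub> (2::nat)"
    and "H = generate G {s}" and "N = submonoid_generated G {s}" and "\<Lambda> = s [^]\<^bsub>G\<^esub> (2::nat)"
  shows "condition_A (G, M, \<Delta>) (H, N, \<Lambda>) (G\<^sub>1, M\<^sub>1, \<Delta>\<^sub>1) (2 * k - 1) \<and>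
         condition_B (G, M, \<Delta>) (H, N, \<Lambda>) (G\<^sub>1, M\<^sub>1, \<Delta>\<^sub>1) (2 * k - 1)"
proof -
  have "1 \<le> k" using assms(1,2) by simp
  from dihedral_action_artin_I2[OF this assms(1)]
  interpret A: dihedral_action G s t k
    "class_act (artin_I2_rels m) (artin_move m)" "\<lambda>a. class_act (artin_I2_rels m) artin_count a 0"
    by (simp only: assms(3-5))
  have "\<Omega> = A.\<Omega>" "\<Delta> = A.\<Delta>"
    by (simp_all only: A.\<Omega>_def A.\<Delta>_def assms(1,7,8))
  moreover have "N = A.powers True" "M\<^sub>1 = A.powers False"
    using A.submonoid_generated_letter[of True] A.submonoid_generated_letter[of False]
    by (simp_all add: assms(10,13))
  ultimately show ?thesis
    using A.condition_A A.condition_B assms(6,11) by (simp only:)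
qed

end
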